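(* Let $(\Omega,\mathcal{A},T,\mu,\mathcal{F},\|\cdot\|,\chi)$ fulfill Property $\mathfrak{D}$, and assume that $\mu(\chi>x)=L(x)/x^{\alpha}$ (for $x>0$), where $L$ is a slowly varying function and $0<\alpha<1$. Let $(b_n)_{n\in\mathbb{N}}$ be a sequence of natural numbers tending to infinity such that $b_n=o(n)$. Define $$d_n:=\frac{\alpha}{1-\alpha}\cdot n^{1/\alpha}\cdot b_n^{1-1/\alpha}\cdot\left(L^{-1/\alpha}\right)^{\#}\left(\left(\frac{n}{b_n}\right)^{1/\alpha}\right).$$ Then $$\lim_{n\to\infty}\mu\left(\left|\frac{\mathsf{S}_n^{b_n}\chi}{d_n}-1\right|>\epsilon\right)=0\qquad\text{for all }\epsilon>0 .$$
   Context: Here $\mathbb{N}=\{1,2,\dots\}$. **Spectral gap.** A bounded linear operator $U:\mathcal{F}\to\mathcal{F}$ on a Banach space has a spectral gap if $U=\lambda P+N$ with $\lambda\in\mathbb{C}$ and $P,N$ bounded linear operators such that $P^2=P$ has one-dimensional image, the spectral radius of $N$ satisfies $\rho(N)<|\lambda|$, and $PN=NP=0$. **Property $\mathfrak{C}$.** Let $(\Omega,\mathcal{A},T,\mu)$ be a dynamical system with $T$ a non-singular transformation, and let $\widehat{T}:\mathcal{L}^1\to\mathcal{L}^1$ be its transfer operator, i.e. the unique operator with $\int\widehat{T}f\cdot g\,\mathrm{d}\mu=\int f\cdot g\circ T\,\mathrm{d}\mu$ for all $f\in\mathcal{L}^1$, $g\in\mathcal{L}^\infty$. Let $\mathcal{F}$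 be a subset of the measurable functions forming a Banach algebra with respect to the norm $\|\cdot\|$. Then $(\Omega,\mathcal{A},T,\mu,\mathcal{F},\|\cdot\|)$ has Property $\mathfrak{C}$ if: (1) $\mu$ is a $T$-invariant, mixing probability measure; (2) $\mathcal{F}$ contains the constant functions and $\|f\|\ge|f|_\infty$ for all $f\in\mathcal{F}$; (3) there is a constant $K_0>0$ with $\|\widehat{T}f\|\le K_0\|f\|$ for all $f\in\mathcal{F}$; (4) $\widehat{T}$ acting on $(\mathcal{F},\|\cdot\|)$ has a spectral gap. **Property $\mathfrak{D}$.** $(\Omega,\mathcal{A},T,\mu,\mathcal{F},\|\cdot\|,\chi)$ has Property $\mathfrak{D}$ if $(\Omega,\mathcal{A},T,\mu,\mathcal{F},\|\cdot\|)$ has Property $\mathfrak{C}$, $\chi:\Omega\to\mathbb{R}_{\ge0}$ is $\mathcal{A}$-measurable, and there is $K_1>0$ such that for all $\ell\in\mathbb{R}_{\ge0}$: $\|\chi\cdot\mathbf{1}_{\{\chi\le\ell\}}\|\le K_1\ell$ and $\|\mathbf{1}_{\{\chi>\ell\}}\|\le K_1$ (in particular, these functions belong to $\mathcal{F}$). **Trimmed sums.** For $n\in\mathbb{N}$ and $b\in\mathbb{N}_0$, $\mathsf{S}_n^{b}\chi$ is the sum of the $n$ values $\chi,\chi\circ T,\dots,\chi\circ T^{n-1}$ with the $b$ largest of them removed: pointwise, if $\chi\circ T^{\sigma(1)}\ge\dots\ge\chi\circ T^{\sigma(n)}$ is a decreasing ordering, where $\sigma:\{1,\dots,n\}\to\{0,\dots,n-1\}$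 is a (point-dependent) bijection, then $\mathsf{S}_n^b\chi=\sum_{k=b+1}^{n}\chi\circ T^{\sigma(k)}$ (an empty sum is $0$). **Slow variation and de Bruijn conjugate.** $L$ is slowly varying if $\lim_{x\to\infty}L(cx)/L(x)=1$ for every $c>0$. For a slowly varying function $\ell$, $\ell^{\#}$ denotes a de Bruijn conjugate of $\ell$, i.e. a slowly varying function with $\lim_{x\to\infty}\ell(x)\,\ell^{\#}(x\ell(x))=1=\lim_{x\to\infty}\ell^{\#}(x)\,\ell(x\ell^{\#}(x))$ (it is unique up to asymptotic equivalence); $L^{-1/\alpha}$ denotes the function $x\mapsto L(x)^{-1/\alpha}$. *)

theory Defs
  imports "HOL-Probability.Probability" "HOL-Library.Landau_Symbols"
begin

section \<open>Dynamical systems and transfer operators\<close>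

locale nonsingular_system =
  fixes M :: "'a measure" and T :: "'a \<Rightarrow> 'a"
  assumes T_measurable: "T \<in> measurable M M"
    and nonsingular: "\<And>A. A \<in> sets M \<Longrightarrow>
      emeasure M (T -` A \<inter> space M) = 0 \<longleftrightarrow> emeasure M A = 0"

definition invariant_measure :: "'a measure \<Rightarrow> ('a \<Rightarrow> 'a) \<Rightarrow> bool" where
  "invariant_measure M T \<longleftrightarrow>
     (\<forall>A \<in> sets M. emeasure M (T -` A \<inter> space M) = emeasure M A)"

definition mixing :: "'a measure \<Rightarrow> ('a \<Rightarrow> 'a) \<Rightarrow> bool" where
  "mixing M T \<longleftrightarrow>
     (\<forall>A \<in> sets M. \<forall>B \<in> sets M.
        (\<lambda>n. measure M (A \<inter> ((T ^^ n) -` B \<inter> space M)))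
          \<longlonglongrightarrow> measure M A * measure M B)"

definition norm_inf :: "'a measure \<Rightarrow> ('a \<Rightarrow> complex) \<Rightarrow> ereal" where
  "norm_inf M f = esssup M (\<lambda>x. ereal (cmod (f x)))"

definition L_inf :: "'a measure \<Rightarrow> ('a \<Rightarrow> complex) set" where
  "L_inf M = {g \<in> borel_measurable M. norm_inf M g < \<infinity>}"

text \<open>
  Elements of \<open>L\<^sup>1\<close> are represented by integrable functions.  The defining identity determines
  \<open>U f\<close> up to a null set, hence \<open>U\<close> as an operator on classes modulo a.e. equality; a function
  \<open>U\<close> on representatives is one choice of versions of the values.
\<close>

definition transfer_operator ::
    "'a measure \<Rightarrow> ('a \<Rightarrow> 'a) \<Rightarrow> (('a \<Rightarrow> complex) \<Rightarrow> ('a \<Rightarrow> complex)) \<Rightarrow> bool" where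
  "transfer_operator M T U \<longleftrightarrow>
     (\<forall>f. integrable M f \<longrightarrow> integrable M (U f) \<and>
        (\<forall>g \<in> L_inf M. (LINT x|M. U f x * g x) = (LINT x|M. f x * g (T x))))"


section \<open>Banach algebras of measurable functions and spectral gaps\<close>

text \<open>
  A Banach algebra consisting of classes of measurable functions modulo a.e. equality is
  represented by the set \<open>F\<close> of all representatives of its elements, with pointwise operations;
  the norm is then definite modulo a.e. equality, and two operators on the algebra are equal if
  their values are a.e. equal.
\<close>

locale function_banach_algebra =
  fixes M :: "'a measure"
    and F :: "('a \<Rightarrow> complex) set"
    and nrm :: "('a \<Rightarrow> complex) \<Rightarrow> real"
  assumes F_measurable: "F \<subseteq> borel_measurable M"
    and F_ae_closed: "\<And>f g. f \<in> F \<Longrightarrow> g \<in> borel_measurable M \<Longrightarrow> (AE x in M. f x = g x) \<Longrightarrow> g \<in> F"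
    and F_zero: "(\<lambda>x. 0) \<in> F"
    and F_add: "\<And>f g. f \<in> F \<Longrightarrow> g \<in> F \<Longrightarrow> (\<lambda>x. f x + g x) \<in> F"
    and F_scale: "\<And>c f. f \<in> F \<Longrightarrow> (\<lambda>x. c * f x) \<in> F"
    and F_mult: "\<And>f g. f \<in> F \<Longrightarrow> g \<in> F \<Longrightarrow> (\<lambda>x. f x * g x) \<in> F"
    and nrm_nonneg: "\<And>f. f \<in> F \<Longrightarrow> 0 \<le> nrm f"
    and nrm_eq_0: "\<And>f. f \<in> F \<Longrightarrow> nrm f = 0 \<longleftrightarrow> (AE x in M. f x = 0)"
    and nrm_scale: "\<And>c f. f \<in> F \<Longrightarrow> nrm (\<lambda>x. c * f x) = cmod c * nrm f"
    and nrm_add: "\<And>f g. f \<in> F \<Longrightarrow> g \<in> F \<Longrightarrow> nrm (\<lambda>x. f x + g x) \<le> nrm f + nrm g"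
    and nrm_mult: "\<And>f g. f \<in> F \<Longrightarrow> g \<in> F \<Longrightarrow> nrm (\<lambda>x. f x * g x) \<le> nrm f * nrm g"
    and complete: "\<And>s. (\<And>n::nat. s n \<in> F) \<Longrightarrow>
      (\<And>e. e > 0 \<Longrightarrow> \<exists>N. \<forall>m\<ge>N. \<forall>n\<ge>N. nrm (\<lambda>x. s m x - s n x) < e) \<Longrightarrow>
      \<exists>f\<in>F. (\<lambda>n. nrm (\<lambda>x. s n x - f x)) \<longlonglongrightarrow> 0"
begin

definition bounded_operator :: "(('a \<Rightarrow> complex) \<Rightarrow> ('a \<Rightarrow> complex)) \<Rightarrow> bool" where
  "bounded_operator U \<longleftrightarrow>
     (\<forall>f\<in>F. U f \<in> F) \<and>
     (\<forall>f\<in>F. \<forall>g\<in>F. AE x in M. U (\<lambda>y. f y + g y) x = U f x + U g x) \<and>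
     (\<forall>c. \<forall>f\<in>F. AE x in M. U (\<lambda>y. c * f y) x = c * U f x) \<and>
     (\<exists>K. \<forall>f\<in>F. nrm (U f) \<le> K * nrm f)"

definition spectrum :: "(('a \<Rightarrow> complex) \<Rightarrow> ('a \<Rightarrow> complex)) \<Rightarrow> complex set" where
  "spectrum U = {z. \<not> (\<exists>R. bounded_operator R \<and>
     (\<forall>f\<in>F. AE x in M. R (\<lambda>y. z * f y - U f y) x = f x) \<and>
     (\<forall>f\<in>F. AE x in M. z * R f x - U (R f) x = f x))}"

definition spectral_radius :: "(('a \<Rightarrow> complex) \<Rightarrow> ('a \<Rightarrow> complex)) \<Rightarrow> ennreal" where
  "spectral_radius U = (SUP z\<in>spectrum U. ennreal (cmod z))"

definition one_dim_image :: "(('a \<Rightarrow> complex) \<Rightarrow> ('a \<Rightarrow> complex)) \<Rightarrow> bool" where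
  "one_dim_image P \<longleftrightarrow>
     (\<exists>f\<^sub>0\<in>F. \<not> (AE x in M. P f\<^sub>0 x = 0) \<and>
        (\<forall>f\<in>F. \<exists>c. AE x in M. P f x = c * P f\<^sub>0 x))"

definition spectral_gap :: "(('a \<Rightarrow> complex) \<Rightarrow> ('a \<Rightarrow> complex)) \<Rightarrow> bool" where
  "spectral_gap U \<longleftrightarrow>
     bounded_operator U \<and>
     (\<exists>lam P N. bounded_operator P \<and> bounded_operator N \<and>
        (\<forall>f\<in>F. AE x in M. U f x = lam * P f x + N f x) \<and>
        (\<forall>f\<in>F. AE x in M. P (P f) x = P f x) \<and>
        one_dim_image P \<and>
        spectral_radius N < ennreal (cmod lam) \<and>
        (\<forall>f\<in>F. AE x in M. P (N f) x = 0) \<and>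
        (\<forall>f\<in>F. AE x in M. N (P f) x = 0))"

end


section \<open>Properties C and D\<close>

locale property_C =
  nonsingular_system M T + prob_space M + function_banach_algebra M F nrm
  for M :: "'a measure" and T :: "'a \<Rightarrow> 'a"
    and F :: "('a \<Rightarrow> complex) set" and nrm :: "('a \<Rightarrow> complex) \<Rightarrow> real" +
  fixes That :: "('a \<Rightarrow> complex) \<Rightarrow> ('a \<Rightarrow> complex)"
  assumes That: "transfer_operator M T That"
    and invariant: "invariant_measure M T"
    and mixing: "mixing M T"
    and F_const: "\<And>c. (\<lambda>x. c) \<in> F"
    and nrm_ge_norm_inf: "\<And>f. f \<in> F \<Longrightarrow> norm_inf M f \<le> ereal (nrm f)"
    and That_bounded: "\<exists>K\<^sub>0>0. \<forall>f\<in>F. That f \<in> F \<and> nrm (That f) \<le> K\<^sub>0 * nrm f"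
    and That_gap: "spectral_gap That"

locale property_D =
  property_C M T F nrm That
  for M :: "'a measure" and T :: "'a \<Rightarrow> 'a"
    and F :: "('a \<Rightarrow> complex) set" and nrm :: "('a \<Rightarrow> complex) \<Rightarrow> real"
    and That :: "('a \<Rightarrow> complex) \<Rightarrow> ('a \<Rightarrow> complex)" +
  fixes chi :: "'a \<Rightarrow> real"
  assumes chi_measurable: "chi \<in> borel_measurable M"
    and chi_nonneg: "\<And>x. x \<in> space M \<Longrightarrow> 0 \<le> chi x"
    and chi_truncated: "\<exists>K\<^sub>1>0. \<forall>l\<ge>0.
      (\<lambda>x. complex_of_real (chi x * indicator {y. chi y \<le> l} x)) \<in> F \<and>
      nrm (\<lambda>x. complex_of_real (chi x * indicator {y. chi y \<le> l} x)) \<le> K\<^sub>1 * l \<and>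
      (\<lambda>x. complex_of_real (indicator {y. chi y > l} x)) \<in> F \<and>
      nrm (\<lambda>x. complex_of_real (indicator {y. chi y > l} x)) \<le> K\<^sub>1"


section \<open>Trimmed sums, slow variation and the norming sequence\<close>

definition trimmed_sum :: "('a \<Rightarrow> 'a) \<Rightarrow> ('a \<Rightarrow> real) \<Rightarrow> nat \<Rightarrow> nat \<Rightarrow> 'a \<Rightarrow> real" where
  "trimmed_sum T chi n b x =
     sum_list (drop b (rev (sort (map (\<lambda>k. chi ((T ^^ k) x)) [0..<n]))))"

text \<open>
  Since \<open>y / 0 = 0\<close>, the case \<open>c = 1\<close> of the following limit forces \<open>L\<close> to be eventually nonzero.
\<close>

definition slowly_varying :: "(real \<Rightarrow> real) \<Rightarrow> bool" where
  "slowly_varying L \<longleftrightarrow> (\<forall>c>0. ((\<lambda>x. L (c * x) / L x) \<longlongrightarrow> 1) at_top)"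

definition de_bruijn_conjugate :: "(real \<Rightarrow> real) \<Rightarrow> (real \<Rightarrow> real) \<Rightarrow> bool" where
  "de_bruijn_conjugate l l' \<longleftrightarrow>
     slowly_varying l' \<and>
     ((\<lambda>x. l x * l' (x * l x)) \<longlongrightarrow> 1) at_top \<and>
     ((\<lambda>x. l' x * l (x * l' x)) \<longlongrightarrow> 1) at_top"

text \<open>\<open>Ls\<close> stands for a de Bruijn conjugate of \<open>L\<close> to the power \<open>-1/\<alpha>\<close>.\<close>

definition norming :: "real \<Rightarrow> (real \<Rightarrow> real) \<Rightarrow> (nat \<Rightarrow> nat) \<Rightarrow> nat \<Rightarrow> real" where
  "norming \<alpha> Ls b n =
     \<alpha> / (1 - \<alpha>) * real n powr (1 / \<alpha>) * real (b n) powr (1 - 1 / \<alpha>)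
       * Ls ((real n / real (b n)) powr (1 / \<alpha>))"

end

theory Submission
  imports Defs
begin

text \<open>
  Write \<open>G x = \<mu>(\<chi> > x)\<close> and \<open>m x = \<integral> \<chi> \<cdot> 1\<^bsub>{\<chi> \<le> x}\<^esub> d\<mu>\<close>.  Trimming the \<open>b\<close> largest of \<open>n\<close>
  values is compared with truncation at a level \<open>l\<close>: if at most \<open>b\<close> of the values exceed \<open>l\<close>, then
  the trimmed sum is at most the sum of the values not exceeding \<open>l\<close>, and if at least \<open>b\<close> of them
  exceed \<open>l\<close>, it is at least that sum (\<open>trimmed_le_truncated\<close>, \<open>truncated_le_trimmed\<close>).

  The de Bruijn conjugate \<open>L\<^sup>#\<close> provides a level \<open>u\<^sub>n = y L\<^sup># y\<close>, where
  \<open>y = (n/b\<^sub>n)\<^bsup>1/\<alpha>\<^esup>\<close>, with \<open>n G u\<^sub>n \<sim> b\<^sub>n\<close> (\<open>calibrated_threshold\<close>), and the norming sequence is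
  \<open>d\<^sub>n = \<alpha>/(1-\<alpha>) b\<^sub>n u\<^sub>n\<close>.  At the level \<open>c u\<^sub>n\<close> the expected number of exceedances is
  asymptotic to \<open>c\<^bsup>-\<alpha>\<^esup> b\<^sub>n\<close>, which is below \<open>b\<^sub>n\<close> for \<open>c > 1\<close> and above it for \<open>c < 1\<close>; and the
  expected truncated sum \<open>n m(c u\<^sub>n)\<close> is asymptotic to \<open>c\<^bsup>1-\<alpha>\<^esup> d\<^sub>n\<close> by Karamata's theorem
  \<open>m x \<sim> \<alpha>/(1-\<alpha>) x G x\<close> (\<open>truncated_mean_asymp\<close>).  So it suffices that both the
  exceedance counts and the truncated sums concentrate around their means; then \<open>c\<close> may be taken
  arbitrarily close to \<open>1\<close> from either side.

  Concentration is Chebyshev's inequality together with the bound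
  \<open>Var (\<Sum>k<n. f \<circ> T\<^sup>k) \<le> C n \<parallel>f\<parallel> \<integral> f d\<mu>\<close> for nonnegative \<open>f \<in> F\<close> (\<open>variance_bound\<close>).
  The norm enters only linearly, so that after division by the squared mean the error is of order \<open>1/b\<^sub>n\<close> for both
  families, whatever the speed at which \<open>b\<^sub>n\<close> grows.  The spectral gap is used in the
  form of a Poisson equation: every \<open>f \<in> F\<close> of mean zero is \<open>g - U g\<close> for the transfer operator
  \<open>U\<close> and some \<open>g \<in> F\<close> with \<open>\<parallel>g\<parallel> \<le> C \<parallel>f\<parallel>\<close> (\<open>exists_corrector\<close>), which makes the sum of the
  correlations of \<open>f\<close> telescope.
\<close>

section \<open>The Poisson equation of the transfer operator\<close>

context function_banach_algebra
begin

lemma F_uminus: "f \<in> F \<Longrightarrow> (\<lambda>x. - f x) \<in> F"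
  using F_scale[of f "-1"] by simp

lemma F_diff: "f \<in> F \<Longrightarrow> g \<in> F \<Longrightarrow> (\<lambda>x. f x - g x) \<in> F"
  using F_add[of f "\<lambda>x. - g x"] F_uminus[of g] by simp

lemma bounded_operator_F: "bounded_operator U \<Longrightarrow> f \<in> F \<Longrightarrow> U f \<in> F"
  unfolding bounded_operator_def by blast

lemma bounded_operator_add:
  "bounded_operator U \<Longrightarrow> f \<in> F \<Longrightarrow> g \<in> F \<Longrightarrow> AE x in M. U (\<lambda>y. f y + g y) x = U f x + U g x"
  unfolding bounded_operator_def by blast

lemma bounded_operator_scale:
  "bounded_operator U \<Longrightarrow> f \<in> F \<Longrightarrow> AE x in M. U (\<lambda>y. c * f y) x = c * U f x"
  unfolding bounded_operator_def by blast

text \<open>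
  Operators act on representatives and are linear only up to null sets; boundedness is what makes
  them respect almost everywhere equality.
\<close>

lemma bounded_operator_null:
  assumes "bounded_operator U" "f \<in> F" "AE x in M. f x = 0"
  shows "AE x in M. U f x = 0"
proof -
  obtain K where K: "\<forall>f\<in>F. nrm (U f) \<le> K * nrm f"
    using assms(1) unfolding bounded_operator_def by blast
  have "nrm f = 0" using nrm_eq_0[OF assms(2)] assms(3) by simp
  hence "nrm (U f) \<le> 0" using K assms(2) by fastforce
  with nrm_nonneg[OF bounded_operator_F[OF assms(1,2)]] have "nrm (U f) = 0" by simp
  thus ?thesis using nrm_eq_0[OF bounded_operator_F[OF assms(1,2)]] by simp
qed

lemma bounded_operator_diff:
  assumes "bounded_operator U" "f \<in> F" "g \<in> F"
  shows "AE x in M. U (\<lambda>y. f y - g y) x = U f x - U g x"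
proof -
  have "AE x in M. U (\<lambda>y. f y + (-1) * g y) x = U f x + U (\<lambda>y. (-1) * g y) x"
    by (rule bounded_operator_add[OF assms(1,2) F_scale[OF assms(3)]])
  moreover have "AE x in M. U (\<lambda>y. (-1) * g y) x = (-1) * U g x"
    by (rule bounded_operator_scale[OF assms(1,3)])
  ultimately show ?thesis by eventually_elim simp
qed

lemma bounded_operator_cong_AE:
  assumes "bounded_operator U" "f \<in> F" "g \<in> F" "AE x in M. f x = g x"
  shows "AE x in M. U f x = U g x"
proof -
  have "AE x in M. U (\<lambda>y. f y - g y) x = 0"
    by (rule bounded_operator_null[OF assms(1) F_diff[OF assms(2,3)]]) (use assms(4) in simp)
  with bounded_operator_diff[OF assms(1-3)] show ?thesis by eventually_elim simp
qed

end

context property_C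
begin

lemma F_borel: "f \<in> F \<Longrightarrow> f \<in> borel_measurable M"
  using F_measurable by blast

lemma F_AE_bound: assumes "f \<in> F" shows "AE x in M. cmod (f x) \<le> nrm f"
proof -
  note [measurable] = F_borel[OF assms]
  have "AE x in M. ereal (cmod (f x)) \<le> norm_inf M f"
    unfolding norm_inf_def by (rule esssup_AE)
  thus ?thesis
  proof eventually_elim
    case (elim x)
    from order_trans[OF elim nrm_ge_norm_inf[OF assms]] show ?case by simp
  qed
qed

lemma L_infI:
  fixes g :: "'a \<Rightarrow> complex"
  assumes "g \<in> borel_measurable M" "AE x in M. cmod (g x) \<le> K"
  shows "g \<in> L_inf M"
proof -
  have "norm_inf M g \<le> ereal K"
    unfolding norm_inf_def by (rule esssup_I) (use assms in auto)
  hence "norm_inf M g < \<infinity>" by (rule le_less_trans) simp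
  with assms(1) show ?thesis by (simp add: L_inf_def)
qed

lemma F_integrable: "f \<in> F \<Longrightarrow> integrable M f"
  by (rule integrable_const_bound[OF F_AE_bound F_borel])

lemma distr_T: "distr M M T = M"
proof (rule measure_eqI)
  fix A assume "A \<in> sets (distr M M T)"
  hence "A \<in> sets M" by simp
  thus "emeasure (distr M M T) A = emeasure M A"
    using invariant T_measurable by (simp add: emeasure_distr invariant_measure_def)
qed simp

lemma integrable_comp_T:
  fixes f :: "'a \<Rightarrow> 'b::{banach,second_countable_topology}"
  assumes "integrable M f"
  shows "integrable M (\<lambda>x. f (T x))"
  using integrable_distr[OF T_measurable, of f] assms by (simp add: distr_T)

lemma integral_comp_T:
  fixes f :: "'a \<Rightarrow> 'b::{banach,second_countable_topology}"
  assumes "f \<in> borel_measurable M"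
  shows "(LINT x|M. f (T x)) = (LINT x|M. f x)"
  using integral_distr[OF T_measurable assms] by (simp add: distr_T)

lemma AE_comp_T: assumes "AE x in M. P x" shows "AE x in M. P (T x)"
  by (rule AE_distrD[OF T_measurable]) (subst distr_T, rule assms)

lemma That_integrable: "integrable M f \<Longrightarrow> integrable M (That f)"
  using That unfolding transfer_operator_def by blast

lemma That_dual:
  "integrable M f \<Longrightarrow> g \<in> L_inf M \<Longrightarrow> (LINT x|M. That f x * g x) = (LINT x|M. f x * g (T x))"
  using That unfolding transfer_operator_def by blast

lemma integral_That: assumes "integrable M f" shows "(LINT x|M. That f x) = (LINT x|M. f x)"
  using That_dual[OF assms L_infI[of "\<lambda>_. 1" 1]] by simp

text \<open>
  Testing \<open>That f\<close> against the conjugate of its own phase turns the duality into an \<open>L\<^sup>1\<close> estimate.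
\<close>

lemma That_L1_contraction:
  assumes "integrable M f"
  shows "(LINT x|M. cmod (That f x)) \<le> (LINT x|M. cmod (f x))"
proof -
  note [measurable] = borel_measurable_integrable[OF assms]
    borel_measurable_integrable[OF That_integrable[OF assms]] T_measurable
  define g where "g x = cnj (sgn (That f x))" for x
  have g_meas [measurable]: "g \<in> borel_measurable M"
    unfolding g_def sgn_div_norm
    by (rule borel_measurable_continuous_on[OF continuous_on_cnj[OF continuous_on_id]]) measurable
  have g1: "cmod (g x) \<le> 1" for x by (simp add: g_def norm_sgn)
  have "That f x * g x = complex_of_real (cmod (That f x))" for x
    by (cases "That f x = 0")
      (simp_all add: g_def sgn_eq complex_norm_square[symmetric] power2_eq_square field_simps)
  hence "complex_of_real (LINT x|M. cmod (That f x)) = (LINT x|M. That f x * g x)"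
    by (simp add: integral_complex_of_real)
  also have "\<dots> = (LINT x|M. f x * g (T x))"
    by (rule That_dual[OF assms]) (rule L_infI[of _ 1], use g1 in auto)
  finally have "complex_of_real (LINT x|M. cmod (That f x)) = (LINT x|M. f x * g (T x))" .
  hence "(LINT x|M. cmod (That f x)) = cmod (LINT x|M. f x * g (T x))"
    by (metis norm_of_real abs_of_nonneg Bochner_Integration.integral_nonneg norm_ge_zero)
  also have "\<dots> \<le> (LINT x|M. cmod (f x * g (T x)))" by (rule integral_norm_bound)
  also have "\<dots> \<le> (LINT x|M. cmod (f x))"
  proof (rule integral_mono)
    show "integrable M (\<lambda>x. cmod (f x * g (T x)))"
      by (rule Bochner_Integration.integrable_bound[OF assms])
        (auto simp: norm_mult intro!: mult_left_le g1)
    show "integrable M (\<lambda>x. cmod (f x))" using assms by simp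
  qed (simp add: norm_mult mult_left_le g1)
  finally show ?thesis .
qed

lemma eigenvalue_le_1:
  assumes "integrable M f" "AE x in M. That f x = c * f x" "\<not> (AE x in M. f x = 0)"
  shows "cmod c \<le> 1"
proof -
  note [measurable] = borel_measurable_integrable[OF assms(1)]
    borel_measurable_integrable[OF That_integrable[OF assms(1)]]
  have "(LINT x|M. cmod (That f x)) = (LINT x|M. cmod c * cmod (f x))"
    by (rule integral_cong_AE) (use assms(2) in \<open>auto simp: norm_mult\<close>)
  hence "cmod c * (LINT x|M. cmod (f x)) \<le> 1 * (LINT x|M. cmod (f x))"
    using That_L1_contraction[OF assms(1)] by simp
  moreover have "(LINT x|M. cmod (f x)) \<noteq> 0"
    using assms(1,3) by (subst integral_nonneg_eq_0_iff_AE) auto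
  hence "(LINT x|M. cmod (f x)) > 0"
    using Bochner_Integration.integral_nonneg[of M "\<lambda>x. cmod (f x)"] by (simp add: order_less_le)
  ultimately show ?thesis by (rule mult_right_le_imp_le)
qed

text \<open>
  Let \<open>lam P + N\<close> be the spectral decomposition.  A nonzero element of the image of \<open>P\<close> is an
  eigenfunction for \<open>lam\<close>, so \<open>|lam| \<le> 1\<close>, since the transfer operator contracts \<open>L\<^sup>1\<close>.
  Hence \<open>N\<close> has spectral radius below \<open>1\<close>, and \<open>1 - N\<close> has a bounded inverse \<open>R\<close>.  If
  \<open>P f = 0\<close>, then \<open>g = R f\<close> also satisfies \<open>P g = 0\<close>, so the transfer operator acts on \<open>g\<close> as \<open>N\<close>
  and \<open>f = g - N g\<close> is the desired equation.  Applied to \<open>f - P f\<close> and integrated, the same argument shows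
  that \<open>P\<close> preserves integrals; as its image is one-dimensional and contains \<open>P 1\<close>, of
  integral \<open>1\<close>, \<open>P\<close> annihilates the functions of mean zero.
\<close>

lemma exists_corrector:
  "\<exists>C\<ge>0. \<forall>f\<in>F. (LINT x|M. f x) = 0 \<longrightarrow>
     (\<exists>g\<in>F. nrm g \<le> C * nrm f \<and> (AE x in M. f x = g x - That g x))"
proof -
  obtain lam P N where P: "bounded_operator P" and N: "bounded_operator N"
    and dec: "\<And>f. f \<in> F \<Longrightarrow> AE x in M. That f x = lam * P f x + N f x"
    and PP: "\<And>f. f \<in> F \<Longrightarrow> AE x in M. P (P f) x = P f x"
    and one: "one_dim_image P"
    and rad: "spectral_radius N < ennreal (cmod lam)"
    and PN: "\<And>f. f \<in> F \<Longrightarrow> AE x in M. P (N f) x = 0"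
    and NP: "\<And>f. f \<in> F \<Longrightarrow> AE x in M. N (P f) x = 0"
    using That_gap unfolding spectral_gap_def by blast
  note PF = bounded_operator_F[OF P] and NF = bounded_operator_F[OF N]
  obtain f0 where f0: "f0 \<in> F" "\<not> (AE x in M. P f0 x = 0)"
    and span: "\<And>f. f \<in> F \<Longrightarrow> \<exists>c. AE x in M. P f x = c * P f0 x"
    using one unfolding one_dim_image_def by blast
  have "AE x in M. That (P f0) x = lam * P f0 x"
    using dec[OF PF[OF f0(1)]] PP[OF f0(1)] NP[OF f0(1)] by eventually_elim simp
  hence "cmod lam \<le> 1" by (rule eigenvalue_le_1[OF F_integrable[OF PF[OF f0(1)]] _ f0(2)])
  have "1 \<notin> spectrum N"
  proof
    assume "1 \<in> spectrum N"
    hence "ennreal (cmod 1) \<le> spectral_radius N" unfolding spectral_radius_def by (rule SUP_upper)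
    hence "ennreal (cmod 1) < ennreal (cmod lam)" using rad by (rule le_less_trans)
    with \<open>cmod lam \<le> 1\<close> show False
      by (metis ennreal_leI leD norm_one)
  qed
  then obtain R where R: "bounded_operator R"
    and RN: "\<And>f. f \<in> F \<Longrightarrow> AE x in M. R f x - N (R f) x = f x"
    unfolding spectrum_def by force
  note RF = bounded_operator_F[OF R]
  \<comment> \<open>On the kernel of \<open>P\<close> the transfer operator coincides with \<open>N\<close>, so the resolvent of \<open>N\<close> solves the equation.\<close>
  have corr: "AE x in M. f x = R f x - That (R f) x"
    if f: "f \<in> F" and Pf: "AE x in M. P f x = 0" for f
  proof -
    have "AE x in M. P (R f) x = P (\<lambda>y. f y + N (R f) y) x"
      by (rule bounded_operator_cong_AE[OF P])
        (use RN[OF f] RF[OF f] NF[OF RF[OF f]] f F_add in \<open>auto simp: algebra_simps\<close>)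
    moreover have "AE x in M. P (\<lambda>y. f y + N (R f) y) x = P f x + P (N (R f)) x"
      by (rule bounded_operator_add[OF P f NF[OF RF[OF f]]])
    ultimately show ?thesis using Pf PN[OF RF[OF f]] dec[OF RF[OF f]] RN[OF f]
      by eventually_elim (simp add: algebra_simps)
  qed
  have intP: "(LINT x|M. P f x) = (LINT x|M. f x)" if f: "f \<in> F" for f
  proof -
    define h where "h = (\<lambda>x. f x - P f x)"
    have h: "h \<in> F" unfolding h_def by (rule F_diff[OF f PF[OF f]])
    have "AE x in M. P h x = 0"
      unfolding h_def using bounded_operator_diff[OF P f PF[OF f]] PP[OF f] by eventually_elim simp
    hence *: "AE x in M. h x = R h x - That (R h) x" by (rule corr[OF h])
    have ints: "integrable M (R h)" "integrable M (That (R h))"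
      by (simp_all add: F_integrable That_integrable RF h)
    have "(LINT x|M. h x) = (LINT x|M. R h x - That (R h) x)"
      by (rule integral_cong_AE) (use * h ints F_borel in auto)
    also have "\<dots> = 0" using ints by (simp add: integral_That)
    finally show ?thesis unfolding h_def using f PF by (simp add: F_integrable)
  qed
  have P0: "AE x in M. P f x = 0" if f: "f \<in> F" and "(LINT x|M. f x) = 0" for f
  proof -
    obtain c where c: "AE x in M. P f x = c * P f0 x" using span[OF f] by blast
    obtain d where d: "AE x in M. P (\<lambda>_. 1) x = d * P f0 x" using span[OF F_const] by blast
    have "(LINT x|M. P f x) = (LINT x|M. c * P f0 x)"
      by (rule integral_cong_AE) (use c PF f f0 F_borel in auto)
    hence c0: "c * (LINT x|M. P f0 x) = 0" using intP[OF f] that by simp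
    have "(LINT x|M. P (\<lambda>_. 1) x) = (LINT x|M. d * P f0 x)"
      by (rule integral_cong_AE) (use d PF F_const f0 F_borel in auto)
    hence "d * (LINT x|M. P f0 x) = 1" using intP[OF F_const[of 1]] by (simp add: prob_space)
    hence "c = 0" using c0 by auto
    with c show ?thesis by simp
  qed
  obtain K where K: "\<forall>f\<in>F. nrm (R f) \<le> K * nrm f"
    using R unfolding bounded_operator_def by blast
  show ?thesis
  proof (rule exI[of _ "max K 0"], intro conjI ballI impI)
    fix f assume f: "f \<in> F" "(LINT x|M. f x) = 0"
    have "nrm (R f) \<le> K * nrm f" using K f by blast
    also have "\<dots> \<le> max K 0 * nrm f" using nrm_nonneg[OF f(1)] by (simp add: mult_right_mono)
    finally show "\<exists>g\<in>F. nrm g \<le> max K 0 * nrm f \<and> (AE x in M. f x = g x - That g x)"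
      using corr[OF f(1) P0[OF f]] RF[OF f(1)] by blast
  qed simp
qed

end

section \<open>Variances of Birkhoff sums and a weak law for arrays\<close>

context property_C
begin

lemma funpow_T_measurable [measurable]: "T ^^ k \<in> measurable M M"
  by (induction k) (auto intro: measurable_compose[OF _ T_measurable] simp: comp_def)

text \<open>
  Let \<open>\<phi> = f - m\<close> be the function centred at its mean \<open>m\<close>, \<open>W\<^sub>n\<close> its Birkhoff sums and \<open>g\<close> its
  corrector.  Since \<open>W\<^sub>n\<^sub>+\<^sub>1 = \<phi> + W\<^sub>n \<circ> T\<close>, the second moment grows in one step by
  \<open>\<integral> \<phi>\<^sup>2 + 2 \<integral> \<phi> (W\<^sub>n \<circ> T)\<close>.  With \<open>\<phi> = g - That g\<close> and duality the cross term is
  \<open>\<integral> g (W\<^sub>n \<circ> T - W\<^sub>n \<circ> T\<^sup>2)\<close>, in which all but the two extreme summands cancel; it is thus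
  at most \<open>2 \<parallel>g\<parallel> \<integral> |\<phi>|\<close>, and \<open>\<integral> |\<phi>| \<le> 2 m\<close> because \<open>f \<ge> 0\<close>.
\<close>

lemma variance_bound:
  "\<exists>C\<ge>0. \<forall>f n. (\<lambda>x. complex_of_real (f x)) \<in> F \<longrightarrow> (\<forall>x\<in>space M. 0 \<le> f x) \<longrightarrow>
     integrable M (\<lambda>x. ((\<Sum>k<n. f ((T ^^ k) x)) - real n * (LINT x|M. f x))\<^sup>2) \<and>
     (LINT x|M. ((\<Sum>k<n. f ((T ^^ k) x)) - real n * (LINT x|M. f x))\<^sup>2)
       \<le> C * real n * (nrm (\<lambda>x. complex_of_real (f x)) * (LINT x|M. f x))"
proof -
  obtain C where C0: "C \<ge> 0" and C: "\<And>f. f \<in> F \<Longrightarrow> (LINT x|M. f x) = 0 \<Longrightarrow>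
     (\<exists>g\<in>F. nrm g \<le> C * nrm f \<and> (AE x in M. f x = g x - That g x))"
    using exists_corrector by blast
  define e where "e = nrm (\<lambda>_. 1)"
  have e0: "e \<ge> 0" unfolding e_def by (rule nrm_nonneg[OF F_const])
  define B where "B = 4 + 8 * (C * (1 + e))"
  have "B \<ge> 0" unfolding B_def using C0 e0 by simp
  show ?thesis
  proof (rule exI[of _ B], intro conjI allI impI)
    fix f :: "'a \<Rightarrow> real" and n
    assume fF: "(\<lambda>x. complex_of_real (f x)) \<in> F" and fpos: "\<forall>x\<in>space M. 0 \<le> f x"
    define K where "K = nrm (\<lambda>x. complex_of_real (f x))"
    define m where "m = (LINT x|M. f x)"
    define \<phi> where "\<phi> x = f x - m" for x
    define W where "W n x = (\<Sum>k<n. \<phi> ((T ^^ k) x))" for n x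
    have K0: "K \<ge> 0" unfolding K_def by (rule nrm_nonneg[OF fF])
    have fm [measurable]: "f \<in> borel_measurable M"
      using measurable_compose[OF F_borel[OF fF] borel_measurable_Re] by simp
    have fi: "integrable M f" using integrable_Re[OF F_integrable[OF fF]] by simp
    have fK: "AE x in M. \<bar>f x\<bar> \<le> K" using F_AE_bound[OF fF] unfolding K_def by simp
    have m0: "m \<ge> 0" unfolding m_def using fpos by (intro Bochner_Integration.integral_nonneg_AE) auto
    have "AE x in M. f x \<le> K" using fK by eventually_elim simp
    from integral_mono_AE[OF fi integrable_const this] have mK: "m \<le> K"
      unfolding m_def by (simp add: prob_space)
    have phim [measurable]: "\<phi> \<in> borel_measurable M" unfolding \<phi>_def by measurable
    have phii: "integrable M \<phi>" unfolding \<phi>_def using fi by simp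
    have phi0: "(LINT x|M. \<phi> x) = 0" unfolding \<phi>_def m_def using fi by (simp add: prob_space)
    have phiK: "AE x in M. \<bar>\<phi> x\<bar> \<le> 2 * K"
      using fK by eventually_elim (use m0 mK in \<open>auto simp: \<phi>_def\<close>)
    have phi1: "(LINT x|M. \<bar>\<phi> x\<bar>) \<le> 2 * m"
    proof -
      have "(LINT x|M. \<bar>\<phi> x\<bar>) \<le> (LINT x|M. f x + m)"
        by (rule integral_mono) (use phii fi fpos m0 in \<open>auto simp: \<phi>_def\<close>)
      also have "\<dots> = 2 * m" using fi by (simp add: prob_space m_def)
      finally show ?thesis .
    qed
    have phiF: "(\<lambda>x. complex_of_real (\<phi> x)) \<in> F"
      using F_diff[OF fF F_const[of "complex_of_real m"]] by (simp add: \<phi>_def)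
    have "nrm (\<lambda>x. complex_of_real (\<phi> x)) \<le> K + m * e"
      using nrm_add[OF fF F_const[of "- complex_of_real m"]] nrm_scale[OF F_const[of 1], of "- complex_of_real m"] m0
      by (simp add: \<phi>_def K_def e_def)
    also have "\<dots> \<le> K * (1 + e)" using mult_right_mono[OF mK e0] by (simp add: algebra_simps)
    finally have phin: "nrm (\<lambda>x. complex_of_real (\<phi> x)) \<le> K * (1 + e)" .
    have "(LINT x|M. complex_of_real (\<phi> x)) = 0"
      using phi0 by (simp add: integral_complex_of_real)
    from C[OF phiF this] obtain g where g: "g \<in> F"
      "nrm g \<le> C * nrm (\<lambda>x. complex_of_real (\<phi> x))"
      and gphi: "AE x in M. complex_of_real (\<phi> x) = g x - That g x"
      by blast
    define G where "G = C * (K * (1 + e))"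
    have gG: "nrm g \<le> G" using order_trans[OF g(2) mult_left_mono[OF phin C0]] unfolding G_def .
    have G0: "G \<ge> 0" unfolding G_def using C0 K0 e0 by simp
    note [measurable] = F_borel[OF g(1)]
    have gi: "integrable M g" by (rule F_integrable[OF g(1)])
    have gK: "AE x in M. cmod (g x) \<le> G" using F_AE_bound[OF g(1)] by eventually_elim (use gG in simp)
    note [measurable] = borel_measurable_integrable[OF That_integrable[OF gi]] T_measurable
    have Wm [measurable]: "W n \<in> borel_measurable M" for n unfolding W_def by measurable
    have WSuc: "W (Suc n) x = \<phi> x + W n (T x)" for n x
      unfolding W_def by (subst sum.lessThan_Suc_shift) (simp add: funpow_swap1)
    have WSuc': "W (Suc n) x = W n x + \<phi> ((T ^^ n) x)" for n x
      unfolding W_def by simp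
    have Wb: "\<exists>c. AE x in M. \<bar>W n x\<bar> \<le> c" for n
    proof (induction n)
      case 0 show ?case by (intro exI[of _ 0]) (simp add: W_def)
    next
      case (Suc n)
      then obtain c where "AE x in M. \<bar>W n x\<bar> \<le> c" by blast
      hence "AE x in M. \<bar>W n (T x)\<bar> \<le> c" by (rule AE_comp_T)
      with phiK have "AE x in M. \<bar>W (Suc n) x\<bar> \<le> 2 * K + c"
        by eventually_elim (simp add: WSuc)
      thus ?case by blast
    qed
    have W2i: "integrable M (\<lambda>x. (W n x)\<^sup>2)" for n
    proof -
      obtain c where "AE x in M. \<bar>W n x\<bar> \<le> c" using Wb by blast
      hence "AE x in M. norm ((W n x)\<^sup>2) \<le> c\<^sup>2"
        by eventually_elim (simp add: abs_le_square_iff[symmetric])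
      thus ?thesis by (rule integrable_const_bound) measurable
    qed
    have phi2: "(LINT x|M. (\<phi> x)\<^sup>2) \<le> 4 * (K * m)"
    proof -
      have "(LINT x|M. (\<phi> x)\<^sup>2) \<le> (LINT x|M. 2 * K * \<bar>\<phi> x\<bar>)"
      proof (rule integral_mono_AE)
        show "integrable M (\<lambda>x. (\<phi> x)\<^sup>2)" using W2i[of 1] by (simp add: W_def)
        show "AE x in M. (\<phi> x)\<^sup>2 \<le> 2 * K * \<bar>\<phi> x\<bar>"
          using phiK by eventually_elim (metis abs_ge_zero mult_right_mono power2_abs power2_eq_square)
      qed (use phii in simp)
      also have "\<dots> \<le> 2 * K * (2 * m)" using mult_left_mono[OF phi1, of "2 * K"] K0 by simp
      finally show ?thesis by simp
    qed
    have phiphi: "(LINT x|M. \<bar>\<phi> ((T ^^ k) x)\<bar>) \<le> 2 * m"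
      "integrable M (\<lambda>x. \<phi> ((T ^^ k) x))" for k
    proof -
      have *: "(LINT x|M. \<bar>\<phi> ((T ^^ k) x)\<bar>) = (LINT x|M. \<bar>\<phi> x\<bar>) \<and> integrable M (\<lambda>x. \<phi> ((T ^^ k) x))"
      proof (induction k)
        case (Suc k)
        have "(LINT x|M. \<bar>\<phi> ((T ^^ Suc k) x)\<bar>) = (LINT x|M. \<bar>\<phi> ((T ^^ k) x)\<bar>)"
          using integral_comp_T[of "\<lambda>x. \<bar>\<phi> ((T ^^ k) x)\<bar>"] by (simp add: funpow_swap1)
        moreover have "integrable M (\<lambda>x. \<phi> ((T ^^ Suc k) x))"
          using integrable_comp_T[of "\<lambda>x. \<phi> ((T ^^ k) x)"] Suc by (simp add: funpow_swap1)
        ultimately show ?case using Suc by simp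
      qed (use phii in simp)
      show "(LINT x|M. \<bar>\<phi> ((T ^^ k) x)\<bar>) \<le> 2 * m" using * phi1 by simp
      show "integrable M (\<lambda>x. \<phi> ((T ^^ k) x))" using * by simp
    qed
    have cross: "integrable M (\<lambda>x. \<phi> x * W n (T x)) \<and> (LINT x|M. \<phi> x * W n (T x)) \<le> 4 * (G * m)" for n
    proof -
      obtain c where "AE x in M. \<bar>W n x\<bar> \<le> c" using Wb by blast
      hence c: "AE x in M. \<bar>W n (T x)\<bar> \<le> c" by (rule AE_comp_T)
      hence c2: "AE x in M. \<bar>W n (T (T x))\<bar> \<le> c" by (rule AE_comp_T)
      let ?w = "\<lambda>x. complex_of_real (W n (T x))"
      have wL: "?w \<in> L_inf M" by (rule L_infI[of _ c]) (use c in auto)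
      have int: "integrable M (\<lambda>x. h x * complex_of_real (v x))"
        if "integrable M h" "AE x in M. \<bar>v x\<bar> \<le> c" "v \<in> borel_measurable M" for h v
      proof -
        have "integrable M (\<lambda>x. complex_of_real (v x) * h x)"
          by (rule Bochner_Integration.integrable_bound[of M "\<lambda>x. c * cmod (h x)"])
            (use that in \<open>auto simp: norm_mult intro!: mult_right_mono elim!: eventually_mono\<close>)
        thus ?thesis by (simp add: mult.commute)
      qed
      have i1: "integrable M (\<lambda>x. complex_of_real (\<phi> x * W n (T x)))"
        using int[OF _ c, of "\<lambda>x. complex_of_real (\<phi> x)"] phii by simp
      have "complex_of_real (LINT x|M. \<phi> x * W n (T x)) = (LINT x|M. (g x - That g x) * ?w x)"
        unfolding integral_complex_of_real[symmetric]
        by (rule integral_cong_AE) (use gphi in auto)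
      also have "\<dots> = (LINT x|M. g x * ?w x) - (LINT x|M. That g x * ?w x)"
        using int[OF gi c] int[OF That_integrable[OF gi] c] by (simp add: left_diff_distrib)
      also have "(LINT x|M. That g x * ?w x) = (LINT x|M. g x * ?w (T x))"
        by (rule That_dual[OF gi wL])
      also have "(LINT x|M. g x * ?w x) - (LINT x|M. g x * ?w (T x))
          = (LINT x|M. g x * ?w x - g x * ?w (T x))"
        using int[OF gi c] int[OF gi c2] by simp
      also have "\<dots> = (LINT x|M. g x * complex_of_real (\<phi> (T x) - \<phi> ((T ^^ n) (T x))))"
      proof (rule Bochner_Integration.integral_cong[OF refl])
        fix x
        have "W n (T x) - W n (T (T x)) = \<phi> (T x) - \<phi> ((T ^^ n) (T x))"
          using WSuc[of n "T x"] WSuc'[of n "T x"] by simp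
        thus "g x * ?w x - g x * ?w (T x) = g x * complex_of_real (\<phi> (T x) - \<phi> ((T ^^ n) (T x)))"
          by (simp add: right_diff_distrib[symmetric] flip: of_real_diff)
      qed
      finally have eq: "complex_of_real (LINT x|M. \<phi> x * W n (T x))
          = (LINT x|M. g x * complex_of_real (\<phi> (T x) - \<phi> ((T ^^ n) (T x))))"
        by (simp add: funpow_swap1)
      have "(LINT x|M. \<phi> x * W n (T x)) \<le> cmod (complex_of_real (LINT x|M. \<phi> x * W n (T x)))" by simp
      also have "\<dots> \<le> (LINT x|M. cmod (g x * complex_of_real (\<phi> (T x) - \<phi> ((T ^^ n) (T x)))))"
        unfolding eq by (rule integral_norm_bound)
      also have "\<dots> \<le> (LINT x|M. G * (\<bar>\<phi> ((T ^^ 1) x)\<bar> + \<bar>\<phi> ((T ^^ Suc n) x)\<bar>))"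
      proof (rule integral_mono_AE')
        show "integrable M (\<lambda>x. G * (\<bar>\<phi> ((T ^^ 1) x)\<bar> + \<bar>\<phi> ((T ^^ Suc n) x)\<bar>))"
          by (intro integrable_mult_right Bochner_Integration.integrable_add integrable_abs phiphi)
        show "AE x in M. cmod (g x * complex_of_real (\<phi> (T x) - \<phi> ((T ^^ n) (T x))))
            \<le> G * (\<bar>\<phi> ((T ^^ 1) x)\<bar> + \<bar>\<phi> ((T ^^ Suc n) x)\<bar>)"
          using gK
        proof eventually_elim
          case (elim x)
          have "\<bar>\<phi> (T x) - \<phi> ((T ^^ n) (T x))\<bar> \<le> \<bar>\<phi> ((T ^^ 1) x)\<bar> + \<bar>\<phi> ((T ^^ Suc n) x)\<bar>"
            by (simp add: funpow_swap1)
          with elim show ?case unfolding norm_mult norm_of_real by (intro mult_mono) (use G0 in auto)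
        qed
      qed (use G0 in simp)
      also have "\<dots> = G * ((LINT x|M. \<bar>\<phi> ((T ^^ 1) x)\<bar>) + (LINT x|M. \<bar>\<phi> ((T ^^ Suc n) x)\<bar>))"
        using integrable_abs[OF phiphi(2)[of 1]] integrable_abs[OF phiphi(2)[of "Suc n"]] by simp
      also have "\<dots> \<le> G * (2 * m + 2 * m)"
        by (intro mult_left_mono add_mono phiphi G0)
      finally have "(LINT x|M. \<phi> x * W n (T x)) \<le> 4 * (G * m)" by simp
      with i1 show ?thesis using complex_of_real_integrable_eq by blast
    qed
    have W2: "(LINT x|M. (W n x)\<^sup>2) \<le> real n * (4 * (K * m) + 8 * (G * m))" for n
    proof (induction n)
      case 0 show ?case by (simp add: W_def)
    next
      case (Suc n)
      have i: "integrable M (\<lambda>x. (W n (T x))\<^sup>2)" by (rule integrable_comp_T[OF W2i])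
      have j: "integrable M (\<lambda>x. (\<phi> x)\<^sup>2)" using W2i[of 1] by (simp add: W_def)
      have "(LINT x|M. (W (Suc n) x)\<^sup>2)
          = (LINT x|M. (\<phi> x)\<^sup>2 + 2 * (\<phi> x * W n (T x)) + (W n (T x))\<^sup>2)"
        by (simp add: WSuc power2_sum algebra_simps)
      also have "\<dots> = (LINT x|M. (\<phi> x)\<^sup>2) + 2 * (LINT x|M. \<phi> x * W n (T x)) + (LINT x|M. (W n (T x))\<^sup>2)"
        using i j cross[of n] by simp
      also have "(LINT x|M. (W n (T x))\<^sup>2) = (LINT x|M. (W n x)\<^sup>2)"
        by (rule integral_comp_T) measurable
      also have "(LINT x|M. (\<phi> x)\<^sup>2) + 2 * (LINT x|M. \<phi> x * W n (T x)) + (LINT x|M. (W n x)\<^sup>2)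
          \<le> 4 * (K * m) + 2 * (4 * (G * m)) + real n * (4 * (K * m) + 8 * (G * m))"
        using phi2 cross[of n] Suc.IH by (intro add_mono) auto
      finally show ?case by (simp add: algebra_simps)
    qed
    have W_eq: "(\<Sum>k<n. f ((T ^^ k) x)) - real n * m = W n x" for x
      unfolding W_def \<phi>_def by (simp add: sum_subtractf)
    have "real n * (4 * (K * m) + 8 * (G * m)) = B * real n * (K * m)"
      unfolding B_def G_def by (simp add: algebra_simps)
    with W2[of n] W2i[of n]
    show "integrable M (\<lambda>x. ((\<Sum>k<n. f ((T ^^ k) x)) - real n * (LINT x|M. f x))\<^sup>2)"
      "(LINT x|M. ((\<Sum>k<n. f ((T ^^ k) x)) - real n * (LINT x|M. f x))\<^sup>2)
       \<le> B * real n * (nrm (\<lambda>x. complex_of_real (f x)) * (LINT x|M. f x))"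
      unfolding m_def[symmetric] K_def[symmetric] W_eq by simp_all
  qed (fact \<open>B \<ge> 0\<close>)
qed

text \<open>
  Chebyshev's inequality for a different function at each \<open>n\<close>.  The probability in question is at most
  a constant times \<open>K n / a n\<close> times the mean divided by \<open>a n\<close>, and the second factor converges.
\<close>

lemma weak_law_array:
  fixes f :: "nat \<Rightarrow> 'a \<Rightarrow> real" and K a :: "nat \<Rightarrow> real"
  assumes ev: "eventually (\<lambda>n. (\<lambda>x. complex_of_real (f n x)) \<in> F \<and> (\<forall>x\<in>space M. 0 \<le> f n x) \<and>
       nrm (\<lambda>x. complex_of_real (f n x)) \<le> K n \<and> 0 < a n) sequentially"
    and mean: "(\<lambda>n. real n * (LINT x|M. f n x) / a n) \<longlonglongrightarrow> \<kappa>"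
    and small: "(\<lambda>n. K n / a n) \<longlonglongrightarrow> 0"
    and "\<eta> > 0"
  shows "(\<lambda>n. measure M {x \<in> space M. \<eta> \<le> \<bar>(\<Sum>k<n. f n ((T ^^ k) x)) / a n - \<kappa>\<bar>}) \<longlonglongrightarrow> 0"
proof -
  obtain C where C0: "C \<ge> 0" and C: "\<And>f n. (\<lambda>x. complex_of_real (f x)) \<in> F \<Longrightarrow> (\<forall>x\<in>space M. 0 \<le> f x) \<Longrightarrow>
     integrable M (\<lambda>x. ((\<Sum>k<n. f ((T ^^ k) x)) - real n * (LINT x|M. f x))\<^sup>2) \<and>
     (LINT x|M. ((\<Sum>k<n. f ((T ^^ k) x)) - real n * (LINT x|M. f x))\<^sup>2)
       \<le> C * real n * (nrm (\<lambda>x. complex_of_real (f x)) * (LINT x|M. f x))"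
    using variance_bound by metis
  let ?m = "\<lambda>n. real n * (LINT x|M. f n x)"
  let ?B = "\<lambda>n. 4 * C / \<eta>\<^sup>2 * (K n / a n) * (?m n / a n)"
  have B: "?B \<longlonglongrightarrow> 4 * C / \<eta>\<^sup>2 * 0 * \<kappa>"
    by (intro tendsto_intros mean small)
  have near: "eventually (\<lambda>n. \<bar>?m n / a n - \<kappa>\<bar> < \<eta> / 2) sequentially"
    using tendstoD[OF mean, of "\<eta> / 2"] \<open>\<eta> > 0\<close> by (simp add: dist_real_def)
  have "eventually (\<lambda>n. measure M {x \<in> space M. \<eta> \<le> \<bar>(\<Sum>k<n. f n ((T ^^ k) x)) / a n - \<kappa>\<bar>} \<le> ?B n) sequentially"
    using ev near
  proof eventually_elim
    case (elim n)
    hence fF: "(\<lambda>x. complex_of_real (f n x)) \<in> F" and pos: "\<forall>x\<in>space M. 0 \<le> f n x"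
      and nK: "nrm (\<lambda>x. complex_of_real (f n x)) \<le> K n" and a: "0 < a n"
      and near: "\<bar>?m n / a n - \<kappa>\<bar> < \<eta> / 2" by auto
    define X where "X x = ((\<Sum>k<n. f n ((T ^^ k) x)) - ?m n)\<^sup>2" for x
    have Xi: "integrable M X" and X: "(LINT x|M. X x) \<le> C * real n * (nrm (\<lambda>x. complex_of_real (f n x)) * (LINT x|M. f n x))"
      using C[OF fF pos, of n] unfolding X_def by auto
    note [measurable] = borel_measurable_integrable[OF Xi]
    have m0: "(LINT x|M. f n x) \<ge> 0" using pos by (intro Bochner_Integration.integral_nonneg_AE) auto
    define c where "c = (\<eta> / 2 * a n)\<^sup>2"
    have c: "c > 0" unfolding c_def using \<open>\<eta> > 0\<close> a by simp
    have "{x \<in> space M. \<eta> \<le> \<bar>(\<Sum>k<n. f n ((T ^^ k) x)) / a n - \<kappa>\<bar>} \<subseteq> {x \<in> space M. c \<le> X x}"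
    proof (intro subsetI CollectI conjI; elim CollectE conjE)
      fix x assume *: "\<eta> \<le> \<bar>(\<Sum>k<n. f n ((T ^^ k) x)) / a n - \<kappa>\<bar>"
      have "\<eta> / 2 \<le> \<bar>(\<Sum>k<n. f n ((T ^^ k) x)) / a n - ?m n / a n\<bar>"
        using * near by argo
      also have "\<dots> = \<bar>(\<Sum>k<n. f n ((T ^^ k) x)) - ?m n\<bar> / a n"
        using a by (simp add: diff_divide_distrib[symmetric])
      finally have "\<eta> / 2 * a n \<le> \<bar>(\<Sum>k<n. f n ((T ^^ k) x)) - ?m n\<bar>" using a by (simp add: field_simps)
      hence "(\<eta> / 2 * a n)\<^sup>2 \<le> \<bar>(\<Sum>k<n. f n ((T ^^ k) x)) - ?m n\<bar>\<^sup>2"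
        by (rule power_mono) (use \<open>\<eta> > 0\<close> a in simp)
      thus "c \<le> X x" unfolding c_def X_def by simp
    qed auto
    hence "measure M {x \<in> space M. \<eta> \<le> \<bar>(\<Sum>k<n. f n ((T ^^ k) x)) / a n - \<kappa>\<bar>}
        \<le> measure M {x \<in> space M. c \<le> X x}"
      by (rule finite_measure_mono) measurable
    also have "\<dots> \<le> (LINT x|M. X x) / c"
      by (rule integral_Markov_inequality_measure[OF Xi sets.empty_sets _ c]) (simp add: X_def)
    also have "\<dots> \<le> (C * real n * (K n * (LINT x|M. f n x))) / c"
    proof (intro divide_right_mono order_trans[OF X] mult_left_mono mult_right_mono nK m0)
      show "0 \<le> C * real n" using C0 by simp
    qed (use c in simp)
    also have "\<dots> = ?B n" unfolding c_def using a \<open>\<eta> > 0\<close> by (simp add: field_simps power2_eq_square)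
    finally show ?case .
  qed
  thus ?thesis
    by (rule tendsto_sandwich[OF always_eventually _ tendsto_const, rotated]) (use B in simp_all)
qed

end

section \<open>Regularly varying tails and truncated means\<close>

text \<open>
  Every \<open>x \<ge> x0\<close> is reached from the fundamental interval \<open>[x0, q x0]\<close> by finitely many
  multiplications by \<open>q\<close>.
\<close>

lemma geometric_scale_induct:
  fixes P :: "real \<Rightarrow> bool"
  assumes "q > 1" "x0 > 0"
    and base: "\<And>x. x0 \<le> x \<Longrightarrow> x \<le> q * x0 \<Longrightarrow> P x"
    and step: "\<And>x. x0 \<le> x \<Longrightarrow> P x \<Longrightarrow> P (q * x)"
    and x: "x \<ge> x0"
  shows "P x"
proof -
  have *: "\<forall>x. x0 \<le> x \<and> x \<le> q ^ Suc k * x0 \<longrightarrow> P x" for k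
  proof (induction k)
    case (Suc k)
    show ?case
    proof (intro allI impI)
      fix x assume x: "x0 \<le> x \<and> x \<le> q ^ Suc (Suc k) * x0"
      show "P x"
      proof (cases "x \<le> q * x0")
        case False
        have "x0 \<le> x / q" "x / q \<le> q ^ Suc k * x0"
          using False x \<open>q > 1\<close> by (auto simp: field_simps)
        with Suc step[of "x / q"] \<open>q > 1\<close> show ?thesis by auto
      qed (use base x in auto)
    qed
  qed (use base in auto)
  obtain k where "x / x0 < q ^ k" using real_arch_pow[OF \<open>q > 1\<close>] by blast
  hence "x \<le> q ^ k * x0" using \<open>x0 > 0\<close> by (simp add: field_simps)
  also have "\<dots> \<le> q ^ Suc k * x0"
    using \<open>q > 1\<close> \<open>x0 > 0\<close> by (intro mult_right_mono power_increasing) auto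
  finally show ?thesis using *[of k] x by blast
qed

locale regularly_varying_tail =
  fixes G :: "real \<Rightarrow> real" and \<alpha> :: real
  assumes alpha: "0 < \<alpha>" "\<alpha> < 1"
    and G_pos: "\<And>x. x > 0 \<Longrightarrow> G x > 0"
    and G_antimono: "\<And>x y. 0 < x \<Longrightarrow> x \<le> y \<Longrightarrow> G y \<le> G x"
    and G_scale: "\<And>c. c > 0 \<Longrightarrow> ((\<lambda>x. G (c * x) / G x) \<longlongrightarrow> c powr (- \<alpha>)) at_top"
begin

lemma xG_scale:
  assumes "c > 0"
  shows "((\<lambda>x. (c * x * G (c * x)) / (x * G x)) \<longlongrightarrow> c powr (1 - \<alpha>)) at_top"
proof -
  have "((\<lambda>x. c * (G (c * x) / G x)) \<longlongrightarrow> c * c powr (- \<alpha>)) at_top"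
    by (intro tendsto_intros G_scale assms)
  also have "c * c powr (- \<alpha>) = c powr (1 - \<alpha>)" using assms by (simp add: powr_diff powr_minus divide_inverse)
  finally show ?thesis
    by (rule Lim_transform_eventually) (use eventually_gt_at_top[of 0] in eventually_elim, simp)
qed

text \<open>
  As \<open>x G x\<close> is regularly varying with index \<open>1 - \<alpha> > 0\<close>, it eventually gains on \<open>x\<^bsup>\<gamma>\<^esup>\<close> under
  doubling as soon as \<open>\<gamma> < 1 - \<alpha>\<close>.
\<close>

lemma xG_at_top: "filterlim (\<lambda>x. x * G x) at_top at_top"
proof -
  define \<gamma> where "\<gamma> = (1 - \<alpha>) / 2"
  have g: "0 < \<gamma>" "\<gamma> < 1 - \<alpha>" using alpha by (auto simp: \<gamma>_def)
  have "2 powr \<gamma> < 2 powr (1 - \<alpha>)" using g by simp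
  hence "eventually (\<lambda>x. (2 * x * G (2 * x)) / (x * G x) > 2 powr \<gamma>) at_top"
    by (intro order_tendstoD(1)[OF xG_scale]) simp_all
  then obtain x1 where x1: "\<And>x. x \<ge> x1 \<Longrightarrow> (2 * x * G (2 * x)) / (x * G x) > 2 powr \<gamma>"
    unfolding eventually_at_top_linorder by blast
  define x0 where "x0 = max x1 1"
  have x0: "x0 \<ge> 1" "x0 > 0" "x0 \<ge> x1" by (auto simp: x0_def)
  define c where "c = G (2 * x0) * x0 / (2 * x0) powr \<gamma>"
  have c: "c > 0" unfolding c_def using x0 G_pos by simp
  have le: "c * x powr \<gamma> \<le> x * G x" if "x \<ge> x0" for x
  proof (rule geometric_scale_induct[of 2 x0 "\<lambda>x. c * x powr \<gamma> \<le> x * G x" x])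
    fix x assume x: "x0 \<le> x" "x \<le> 2 * x0"
    have "c * x powr \<gamma> \<le> c * (2 * x0) powr \<gamma>"
      using x x0 c g by (intro mult_left_mono powr_mono2) auto
    also have "\<dots> = x0 * G (2 * x0)" unfolding c_def using x0 by simp
    also have "\<dots> \<le> x * G x"
      using x x0 G_antimono[of x "2 * x0"] G_pos[of "2 * x0"] by (intro mult_mono) auto
    finally show "c * x powr \<gamma> \<le> x * G x" .
  next
    fix x assume x: "x0 \<le> x" "c * x powr \<gamma> \<le> x * G x"
    have pos: "x * G x > 0" using x x0 G_pos by simp
    have "c * (2 * x) powr \<gamma> = 2 powr \<gamma> * (c * x powr \<gamma>)" using x x0 by (simp add: powr_mult)
    also have "\<dots> \<le> 2 powr \<gamma> * (x * G x)" using x by simp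
    also have "\<dots> \<le> 2 * x * G (2 * x)"
      using less_imp_le[OF x1[of x]] x x0 pos by (simp only: pos_le_divide_eq)
    finally show "c * (2 * x) powr \<gamma> \<le> 2 * x * G (2 * x)" .
  qed (use x0 that in auto)
  have "filterlim (\<lambda>x. c * x powr \<gamma>) at_top at_top"
  proof (rule filterlim_tendsto_pos_mult_at_top[OF tendsto_const c])
    have "filterlim (\<lambda>x. exp (\<gamma> * ln x)) at_top at_top"
      by (rule filterlim_compose[OF exp_at_top
            filterlim_tendsto_pos_mult_at_top[OF tendsto_const g(1) ln_at_top]])
    thus "filterlim (\<lambda>x. x powr \<gamma>) at_top at_top"
      by (rule filterlim_mono_eventually)
        (use eventually_gt_at_top[of 0] in \<open>auto simp: powr_def elim: eventually_mono\<close>)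
  qed
  thus ?thesis
    by (rule filterlim_at_top_mono) (rule eventually_mono[OF eventually_ge_at_top[of x0] le])
qed

text \<open>
  Over a block \<open>[x, q x]\<close> the truncated mean grows by an amount between \<open>x (G x - G (q x))\<close> and
  \<open>q x (G x - G (q x))\<close>, while \<open>x G x\<close> grows asymptotically by \<open>(q\<^bsup>1-\<alpha>\<^esup> - 1) x G x\<close>.  As \<open>q\<close>
  decreases to \<open>1\<close>, the quotients of these growths come close to \<open>\<alpha>/(1-\<alpha>)\<close>.  The following
  two lemmas choose \<open>q\<close> for a given \<open>c\<close> on either side of this value; at \<open>q = 1\<close> both sides of
  the inequality vanish, and the derivatives there decide.
\<close>
lemma exists_ratio_above:
  assumes "c > \<alpha> / (1 - \<alpha>)"
  shows "\<exists>q>1. q * (1 - q powr (- \<alpha>)) < c * (q powr (1 - \<alpha>) - 1)"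
proof -
  define \<psi> where "\<psi> q = c * (q powr (1 - \<alpha>) - 1) - q * (1 - q powr (- \<alpha>))" for q
  have "(\<psi> has_real_derivative c * (1 - \<alpha>) - \<alpha>) (at 1)"
    unfolding \<psi>_def by (auto intro!: derivative_eq_intros)
  moreover have "c * (1 - \<alpha>) - \<alpha> > 0" using assms alpha by (simp add: field_simps)
  ultimately obtain d where "d > 0" "\<forall>h>0. h < d \<longrightarrow> \<psi> 1 < \<psi> (1 + h)"
    using DERIV_pos_inc_right by blast
  hence "\<psi> 1 < \<psi> (1 + d / 2)" by simp
  hence "0 < \<psi> (1 + d / 2)" by (simp add: \<psi>_def)
  thus ?thesis unfolding \<psi>_def using \<open>d > 0\<close> by (intro exI[of _ "1 + d / 2"]) simp
qed

lemma exists_ratio_below: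
  assumes "c < \<alpha> / (1 - \<alpha>)"
  shows "\<exists>q>1. c * (q powr (1 - \<alpha>) - 1) < 1 - q powr (- \<alpha>)"
proof -
  define \<psi> where "\<psi> q = 1 - q powr (- \<alpha>) - c * (q powr (1 - \<alpha>) - 1)" for q
  have "(\<psi> has_real_derivative \<alpha> - c * (1 - \<alpha>)) (at 1)"
    unfolding \<psi>_def by (auto intro!: derivative_eq_intros)
  moreover have "\<alpha> - c * (1 - \<alpha>) > 0" using assms alpha by (simp add: field_simps)
  ultimately obtain d where "d > 0" "\<forall>h>0. h < d \<longrightarrow> \<psi> 1 < \<psi> (1 + h)"
    using DERIV_pos_inc_right by blast
  hence "\<psi> 1 < \<psi> (1 + d / 2)" by simp
  hence "0 < \<psi> (1 + d / 2)" by (simp add: \<psi>_def)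
  thus ?thesis unfolding \<psi>_def using \<open>d > 0\<close> by (intro exI[of _ "1 + d / 2"]) simp
qed

text \<open>
  Karamata's theorem in the form of a discrete l'Hospital rule.  For \<open>c\<close> above the limit and a suitable
  \<open>q > 1\<close>, \<open>m x - c x G x\<close> eventually does not increase under \<open>x \<mapsto> q x\<close>, hence is
  bounded above, and the bound is negligible because \<open>x G x\<close> tends to infinity.  For \<open>c\<close> below
  the limit the argument is symmetric.
\<close>

lemma truncated_mean_asymp:
  assumes m_nonneg: "\<And>x. x > 0 \<Longrightarrow> 0 \<le> m x" and m_le: "\<And>x. x > 0 \<Longrightarrow> m x \<le> x"
    and lo: "\<And>x y. 0 < x \<Longrightarrow> x \<le> y \<Longrightarrow> x * (G x - G y) \<le> m y - m x"
    and hi: "\<And>x y. 0 < x \<Longrightarrow> x \<le> y \<Longrightarrow> m y - m x \<le> y * (G x - G y)"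
  shows "((\<lambda>x. m x / (x * G x)) \<longlongrightarrow> \<alpha> / (1 - \<alpha>)) at_top"
proof (rule order_tendstoI)
  fix c' assume c': "c' > \<alpha> / (1 - \<alpha>)"
  then obtain c where c: "c > \<alpha> / (1 - \<alpha>)" "c < c'" using dense by blast
  have "\<alpha> / (1 - \<alpha>) > 0" using alpha by simp
  hence c0: "c > 0" using c by linarith
  obtain q where q: "q > 1" "q * (1 - q powr (- \<alpha>)) < c * (q powr (1 - \<alpha>) - 1)"
    using exists_ratio_above[OF c(1)] by blast
  have "((\<lambda>x. c * ((q * x * G (q * x)) / (x * G x) - 1) - q * (1 - G (q * x) / G x))
      \<longlongrightarrow> c * (q powr (1 - \<alpha>) - 1) - q * (1 - q powr (- \<alpha>))) at_top"
    using q by (intro tendsto_intros xG_scale G_scale) auto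
  hence "eventually (\<lambda>x. c * ((q * x * G (q * x)) / (x * G x) - 1) - q * (1 - G (q * x) / G x) > 0) at_top"
    by (rule order_tendstoD(1)) (use q in simp)
  then obtain x1 where x1: "\<And>x. x \<ge> x1 \<Longrightarrow>
      c * ((q * x * G (q * x)) / (x * G x) - 1) - q * (1 - G (q * x) / G x) > 0"
    unfolding eventually_at_top_linorder by blast
  define x0 where "x0 = max x1 1"
  have x0: "x0 > 0" "x0 \<ge> x1" by (auto simp: x0_def)
  have le: "m x - c * (x * G x) \<le> q * x0" if "x \<ge> x0" for x
  proof (rule geometric_scale_induct[of q x0 "\<lambda>x. m x - c * (x * G x) \<le> q * x0" x])
    fix x assume x: "x0 \<le> x" "x \<le> q * x0"
    have "x * G x > 0" using x x0 G_pos by simp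
    hence "c * (x * G x) > 0" using c0 by simp
    with m_le[of x] x x0 show "m x - c * (x * G x) \<le> q * x0" by simp
  next
    fix x assume x: "x0 \<le> x" "m x - c * (x * G x) \<le> q * x0"
    have pos: "x > 0" "G x > 0" using x x0 G_pos by auto
    have "m (q * x) - m x \<le> q * x * (G x - G (q * x))" using hi[of x "q * x"] pos q by simp
    also have "\<dots> = (q * (1 - G (q * x) / G x)) * (x * G x)" using pos by (simp add: field_simps)
    also have "\<dots> \<le> (c * ((q * x * G (q * x)) / (x * G x) - 1)) * (x * G x)"
      using x1[of x] x x0 pos by (intro mult_right_mono) auto
    also have "\<dots> = c * (q * x * G (q * x)) - c * (x * G x)" using pos by (simp add: field_simps)
    finally show "m (q * x) - c * (q * x * G (q * x)) \<le> q * x0" using x by simp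
  qed (use q x0 that in auto)
  have "eventually (\<lambda>x. x * G x > q * x0 / (c' - c)) at_top"
    using xG_at_top by (simp add: filterlim_at_top_dense)
  thus "eventually (\<lambda>x. m x / (x * G x) < c') at_top"
    using eventually_ge_at_top[of x0]
  proof eventually_elim
    case (elim x)
    have pos: "x * G x > 0" using elim x0 G_pos by simp
    have "q * x0 < (c' - c) * (x * G x)" using elim(1) c by (simp add: field_simps)
    with le[OF elim(2)] have "m x < c' * (x * G x)" by (simp add: algebra_simps)
    thus ?case using pos by (simp add: pos_divide_less_eq)
  qed
next
  fix c' assume c': "c' < \<alpha> / (1 - \<alpha>)"
  have a0: "\<alpha> / (1 - \<alpha>) > 0" using alpha by simp
  with c' have "max c' 0 < \<alpha> / (1 - \<alpha>)" by simp
  then obtain c where c: "c < \<alpha> / (1 - \<alpha>)" "max c' 0 < c" using dense by blast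
  have c0: "c > 0" using c by linarith
  obtain q where q: "q > 1" "c * (q powr (1 - \<alpha>) - 1) < 1 - q powr (- \<alpha>)"
    using exists_ratio_below[OF c(1)] by blast
  have "((\<lambda>x. (1 - G (q * x) / G x) - c * ((q * x * G (q * x)) / (x * G x) - 1))
      \<longlongrightarrow> (1 - q powr (- \<alpha>)) - c * (q powr (1 - \<alpha>) - 1)) at_top"
    using q by (intro tendsto_intros xG_scale G_scale) auto
  hence "eventually (\<lambda>x. (1 - G (q * x) / G x) - c * ((q * x * G (q * x)) / (x * G x) - 1) > 0) at_top"
    by (rule order_tendstoD(1)) (use q in simp)
  then obtain x1 where x1: "\<And>x. x \<ge> x1 \<Longrightarrow>
      (1 - G (q * x) / G x) - c * ((q * x * G (q * x)) / (x * G x) - 1) > 0"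
    unfolding eventually_at_top_linorder by blast
  define x0 where "x0 = max x1 1"
  have x0: "x0 > 0" "x0 \<ge> x1" by (auto simp: x0_def)
  define B where "B = c * (q * x0 * G x0)"
  have le: "m x - c * (x * G x) \<ge> - B" if "x \<ge> x0" for x
  proof (rule geometric_scale_induct[of q x0 "\<lambda>x. m x - c * (x * G x) \<ge> - B" x])
    fix x assume x: "x0 \<le> x" "x \<le> q * x0"
    have "x * G x \<le> q * x0 * G x0"
      using x x0 q G_pos[of x] G_antimono[of x0 x] by (intro mult_mono) auto
    hence "c * (x * G x) \<le> B" unfolding B_def using c0 by (intro mult_left_mono) auto
    with m_nonneg[of x] x x0 show "m x - c * (x * G x) \<ge> - B" by simp
  next
    fix x assume x: "x0 \<le> x" "m x - c * (x * G x) \<ge> - B"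
    have pos: "x > 0" "G x > 0" using x x0 G_pos by auto
    have "c * (q * x * G (q * x)) - c * (x * G x) = (c * ((q * x * G (q * x)) / (x * G x) - 1)) * (x * G x)"
      using pos by (simp add: field_simps)
    also have "\<dots> \<le> (1 - G (q * x) / G x) * (x * G x)"
      using x1[of x] x x0 pos by (intro mult_right_mono) auto
    also have "\<dots> = x * (G x - G (q * x))" using pos by (simp add: field_simps)
    also have "\<dots> \<le> m (q * x) - m x" using lo[of x "q * x"] pos q by simp
    finally show "m (q * x) - c * (q * x * G (q * x)) \<ge> - B" using x by simp
  qed (use q x0 that in auto)
  have "eventually (\<lambda>x. x * G x > B / (c - c')) at_top"
    using xG_at_top by (simp add: filterlim_at_top_dense)
  thus "eventually (\<lambda>x. m x / (x * G x) > c') at_top"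
    using eventually_ge_at_top[of x0]
  proof eventually_elim
    case (elim x)
    have pos: "x * G x > 0" using elim x0 G_pos by simp
    have "B < (c - c') * (x * G x)" using elim(1) c by (simp add: field_simps)
    with le[OF elim(2)] have "m x > c' * (x * G x)" by (simp add: algebra_simps)
    thus ?case using pos by (simp add: pos_less_divide_eq)
  qed
qed

end

text \<open>
  At \<open>x = y Ls y\<close> the conjugacy relation reads \<open>Ls y \<sim> L(x)\<^bsup>1/\<alpha>\<^esup>\<close>, so
  \<open>G x = L x / (y Ls y)\<^bsup>\<alpha>\<^esup> \<sim> y\<^bsup>-\<alpha>\<^esup>\<close>.
\<close>

lemma calibrated_threshold:
  fixes G L Ls :: "real \<Rightarrow> real"
  assumes alpha: "0 < \<alpha>"
    and G0: "\<And>x. G x \<ge> 0"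
    and L: "\<And>x. x > 0 \<Longrightarrow> G x = L x / x powr \<alpha>"
    and db: "de_bruijn_conjugate (\<lambda>x. L x powr (- 1 / \<alpha>)) Ls"
  shows "((\<lambda>y. y powr \<alpha> * G (y * Ls y)) \<longlongrightarrow> 1) at_top" "eventually (\<lambda>y. y * Ls y > 0) at_top"
proof -
  have lim: "((\<lambda>y. Ls y * L (y * Ls y) powr (- 1 / \<alpha>)) \<longlongrightarrow> 1) at_top"
    using db unfolding de_bruijn_conjugate_def by blast
  have ev: "eventually (\<lambda>y. Ls y > 0 \<and> L (y * Ls y) > 0 \<and> y > 0) at_top"
    using order_tendstoD(1)[OF lim zero_less_one] eventually_gt_at_top[of 0]
  proof eventually_elim
    case (elim y)
    hence Ls: "Ls y > 0" by (metis mult_nonpos_nonneg not_less powr_ge_zero)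
    have "L (y * Ls y) \<noteq> 0" using elim by auto
    moreover have "L (y * Ls y) \<ge> 0"
      using L[of "y * Ls y"] G0[of "y * Ls y"] elim Ls by (simp add: zero_le_divide_iff)
    ultimately show ?case using elim Ls by simp
  qed
  thus "eventually (\<lambda>y. y * Ls y > 0) at_top" by eventually_elim simp
  have "((\<lambda>y. (Ls y * L (y * Ls y) powr (- 1 / \<alpha>)) powr (- \<alpha>)) \<longlongrightarrow> 1 powr (- \<alpha>)) at_top"
    by (intro tendsto_powr lim tendsto_const) simp
  moreover have "eventually (\<lambda>y. (Ls y * L (y * Ls y) powr (- 1 / \<alpha>)) powr (- \<alpha>)
      = y powr \<alpha> * G (y * Ls y)) at_top"
    using ev
  proof eventually_elim
    case (elim y)
    hence "(Ls y * L (y * Ls y) powr (- 1 / \<alpha>)) powr (- \<alpha>)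
        = Ls y powr (- \<alpha>) * (L (y * Ls y) powr (- 1 / \<alpha>)) powr (- \<alpha>)"
      by (simp only: powr_mult)
    also have "(L (y * Ls y) powr (- 1 / \<alpha>)) powr (- \<alpha>) = L (y * Ls y)"
      using elim alpha by (simp add: powr_powr)
    also have "Ls y powr (- \<alpha>) * L (y * Ls y) = y powr \<alpha> * G (y * Ls y)"
      using elim by (simp add: L powr_mult powr_minus field_simps)
    finally show ?case .
  qed
  ultimately show "((\<lambda>y. y powr \<alpha> * G (y * Ls y)) \<longlongrightarrow> 1) at_top"
    by (simp add: tendsto_cong)
qed

section \<open>Trimming and truncating finite lists\<close>

lemma rev_sort_split:
  fixes xs :: "real list"
  shows "rev (sort xs) = rev (sort (filter (\<lambda>x. x > l) xs)) @ rev (sort (filter (\<lambda>x. x \<le> l) xs))"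
proof -
  have "sort xs = sort (filter (\<lambda>x. x \<le> l) xs) @ sort (filter (\<lambda>x. x > l) xs)"
  proof (rule properties_for_sort)
    show "sorted (sort (filter (\<lambda>x. x \<le> l) xs) @ sort (filter (\<lambda>x. x > l) xs))"
      by (auto simp: sorted_append)
    have "filter (\<lambda>x. x > l) xs = filter (\<lambda>x. \<not> x \<le> l) xs" by (simp add: not_le)
    thus "mset (sort (filter (\<lambda>x. x \<le> l) xs) @ sort (filter (\<lambda>x. x > l) xs)) = mset xs"
      using multiset_partition[of "mset xs" "\<lambda>x. x \<le> l"] by simp
  qed
  thus ?thesis by simp
qed

lemma sum_list_drop_le:
  fixes xs :: "real list"
  assumes "\<And>x. x \<in> set xs \<Longrightarrow> 0 \<le> x"
  shows "sum_list (drop k xs) \<le> sum_list xs"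
proof -
  have "sum_list xs = sum_list (take k xs) + sum_list (drop k xs)"
    by (metis append_take_drop_id sum_list_append)
  moreover have "sum_list (take k xs) \<ge> 0"
    by (rule sum_list_nonneg, rule assms, erule in_set_takeD)
  ultimately show ?thesis by simp
qed

lemma sum_list_sort: "sum_list (sort xs) = sum_list (xs :: real list)"
proof -
  have "sum_mset (mset (sort xs)) = sum_mset (mset xs)" by simp
  thus ?thesis unfolding sum_mset_sum_list .
qed

text \<open>
  In a decreasing ordering the values above \<open>l\<close> come first, so here all of them are among the removed
  ones, and possibly some of the others as well.
\<close>

lemma trimmed_le_truncated:
  fixes xs :: "real list"
  assumes "\<And>x. x \<in> set xs \<Longrightarrow> 0 \<le> x" "length (filter (\<lambda>x. x > l) xs) \<le> b"
  shows "sum_list (drop b (rev (sort xs))) \<le> sum_list (filter (\<lambda>x. x \<le> l) xs)"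
proof -
  have "sum_list (drop b (rev (sort xs)))
      = sum_list (drop (b - length (filter (\<lambda>x. x > l) xs)) (rev (sort (filter (\<lambda>x. x \<le> l) xs))))"
    by (simp only: rev_sort_split[of xs l]) (simp add: assms)
  also have "\<dots> \<le> sum_list (rev (sort (filter (\<lambda>x. x \<le> l) xs)))"
    by (rule sum_list_drop_le) (use assms in auto)
  finally show ?thesis by (simp add: sum_list_sort sum_list_rev)
qed

text \<open>
  Here only values above \<open>l\<close> are removed, and those that survive contribute nonnegatively.
\<close>

lemma truncated_le_trimmed:
  fixes xs :: "real list"
  assumes "l \<ge> 0" "b \<le> length (filter (\<lambda>x. x > l) xs)"
  shows "sum_list (filter (\<lambda>x. x \<le> l) xs) \<le> sum_list (drop b (rev (sort xs)))"
proof -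
  have "sum_list (drop b (rev (sort xs)))
      = sum_list (drop b (rev (sort (filter (\<lambda>x. x > l) xs)))) + sum_list (filter (\<lambda>x. x \<le> l) xs)"
    by (simp only: rev_sort_split[of xs l]) (simp add: assms sum_list_sort sum_list_rev)
  moreover have "sum_list (drop b (rev (sort (filter (\<lambda>x. x > l) xs)))) \<ge> 0"
    by (rule sum_list_nonneg, drule in_set_dropD) (use assms in simp)
  ultimately show ?thesis by simp
qed

lemma truncated_sum_eq:
  "sum_list (filter (\<lambda>x. x \<le> l) (map (\<lambda>k. chi ((T ^^ k) x)) [0..<n]))
     = (\<Sum>k<n. chi ((T ^^ k) x) * indicator {y. chi y \<le> l} ((T ^^ k) x) :: real)"
  by (induction n) auto

lemma exceedances_eq:
  "real (length (filter (\<lambda>x. x > l) (map (\<lambda>k. chi ((T ^^ k) x)) [0..<n])))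
     = (\<Sum>k<n. indicator {y. chi y > (l::real)} ((T ^^ k) x))"
  by (induction n) auto

section \<open>Trimmed sums along orbits\<close>

context property_D
begin

definition tail :: "real \<Rightarrow> real" where
  "tail l = measure M {\<omega> \<in> space M. chi \<omega> > l}"

definition truncated_mean :: "real \<Rightarrow> real" where
  "truncated_mean l = (LINT \<omega>|M. chi \<omega> * indicator {y. chi y \<le> l} \<omega>)"

lemma truncation_integrable:
  assumes "l \<ge> 0"
  shows "integrable M (\<lambda>\<omega>. chi \<omega> * indicator {y. chi y \<le> l} \<omega>)"
    and "integrable M (\<lambda>\<omega>. indicator {y. chi y > l} \<omega> :: real)"
  using chi_truncated assms F_integrable complex_of_real_integrable_eq by blast+

lemma tail_eq_integral: "tail l = (LINT \<omega>|M. indicator {y. chi y > l} \<omega>)"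
proof -
  note [measurable] = chi_measurable
  have "(LINT \<omega>|M. indicator {y. chi y > l} \<omega>) = (LINT \<omega>|M. indicator {\<omega> \<in> space M. chi \<omega> > l} \<omega> :: real)"
    by (rule Bochner_Integration.integral_cong) (auto simp: indicator_def)
  thus ?thesis unfolding tail_def by simp
qed

lemma truncated_mean_nonneg: "0 \<le> truncated_mean l"
  unfolding truncated_mean_def
  by (rule Bochner_Integration.integral_nonneg_AE) (auto simp: chi_nonneg)

lemma truncated_mean_le: assumes "l > 0" shows "truncated_mean l \<le> l"
proof -
  have "truncated_mean l \<le> (LINT \<omega>|M. l)"
    unfolding truncated_mean_def using assms
    by (intro integral_mono truncation_integrable) (auto simp: indicator_def)
  thus ?thesis by (simp add: prob_space)
qed

lemma truncated_mean_increment: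
  assumes "0 < x" "x \<le> y"
  shows "x * (tail x - tail y) \<le> truncated_mean y - truncated_mean x"
    and "truncated_mean y - truncated_mean x \<le> y * (tail x - tail y)"
proof -
  let ?t = "\<lambda>l \<omega>. chi \<omega> * indicator {y. chi y \<le> l} \<omega>"
  let ?e = "\<lambda>l \<omega>. indicator {y. chi y > l} \<omega> :: real"
  note ints = truncation_integrable[of x] truncation_integrable[of y]
  have m: "truncated_mean y - truncated_mean x = (LINT \<omega>|M. ?t y \<omega> - ?t x \<omega>)"
    unfolding truncated_mean_def using ints assms by simp
  have g: "c * (tail x - tail y) = (LINT \<omega>|M. c * (?e x \<omega> - ?e y \<omega>))" for c
    unfolding tail_eq_integral using ints assms by simp
  show "x * (tail x - tail y) \<le> truncated_mean y - truncated_mean x"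
    unfolding m g using ints assms by (intro integral_mono) (auto simp: indicator_def)
  show "truncated_mean y - truncated_mean x \<le> y * (tail x - tail y)"
    unfolding m g using ints assms by (intro integral_mono) (auto simp: indicator_def)
qed

text \<open>
  The weak law is applied four times: to the exceedance counts (\<open>A\<close>) and to the truncated sums
  (\<open>B\<close>), at a level slightly above and one slightly below \<open>u n\<close>.  Outside these four events of
  vanishing probability the trimmed sum lies between the two truncated sums.
\<close>

lemma trimmed_sum_weak_law:
  fixes u :: "nat \<Rightarrow> real" and b :: "nat \<Rightarrow> nat"
  assumes rv: "regularly_varying_tail tail \<alpha>"
    and u: "filterlim u at_top sequentially"
    and b: "filterlim b at_top sequentially"
    and calib: "(\<lambda>n. real n * tail (u n) / real (b n)) \<longlonglongrightarrow> 1"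
    and "\<epsilon> > 0"
  shows "(\<lambda>n. measure M {\<omega> \<in> space M.
     \<bar>trimmed_sum T chi n (b n) \<omega> / (\<alpha> / (1 - \<alpha>) * real (b n) * u n) - 1\<bar> > \<epsilon>}) \<longlonglongrightarrow> 0"
proof -
  interpret regularly_varying_tail tail \<alpha> by (rule rv)
  note [measurable] = chi_measurable
  define D where "D n = \<alpha> / (1 - \<alpha>) * real (b n) * u n" for n
  let ?t = "\<lambda>l \<omega>. chi \<omega> * indicator {y. chi y \<le> l} \<omega>"
  let ?e = "\<lambda>l \<omega>. indicator {y. chi y > l} \<omega> :: real"
  obtain K where K: "K > 0" "\<And>l. l \<ge> 0 \<Longrightarrow>
      (\<lambda>x. complex_of_real (?t l x)) \<in> F \<and> nrm (\<lambda>x. complex_of_real (?t l x)) \<le> K * l \<and>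
      (\<lambda>x. complex_of_real (?e l x)) \<in> F \<and> nrm (\<lambda>x. complex_of_real (?e l x)) \<le> K"
    using chi_truncated by blast
  have ratio: "\<alpha> / (1 - \<alpha>) > 0" using alpha by simp
  have u0: "eventually (\<lambda>n. u n > 0) sequentially" using u by (simp add: filterlim_at_top_dense)
  have b0: "eventually (\<lambda>n. b n > 0) sequentially"
    using eventually_compose_filterlim[OF eventually_gt_at_top b] .
  have D0: "eventually (\<lambda>n. D n > 0) sequentially"
    using u0 b0 by eventually_elim (use ratio in \<open>simp add: D_def del: times_divide_eq_left\<close>)
  have inv_b: "(\<lambda>n. inverse (real (b n))) \<longlonglongrightarrow> 0"
    by (rule tendsto_inverse_0_at_top[OF filterlim_compose[OF filterlim_real_sequentially b]])
  have cu: "filterlim (\<lambda>n. c * u n) at_top sequentially" if "c > 0" for c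
    by (rule filterlim_tendsto_pos_mult_at_top[OF tendsto_const that u])
  have tail_c: "(\<lambda>n. real n * tail (c * u n) / real (b n)) \<longlonglongrightarrow> c powr (- \<alpha>)" if c: "c > 0" for c
  proof -
    have "(\<lambda>n. (tail (c * u n) / tail (u n)) * (real n * tail (u n) / real (b n))) \<longlonglongrightarrow> c powr (- \<alpha>) * 1"
      by (intro tendsto_mult calib filterlim_compose[OF G_scale[OF c] u])
    moreover have "eventually (\<lambda>n. (tail (c * u n) / tail (u n)) * (real n * tail (u n) / real (b n))
        = real n * tail (c * u n) / real (b n)) sequentially"
      using u0
    proof eventually_elim
      case (elim n)
      thus ?case using G_pos[of "u n"] by simp
    qed
    ultimately have "(\<lambda>n. real n * tail (c * u n) / real (b n)) \<longlonglongrightarrow> c powr (- \<alpha>) * 1"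
      by (rule Lim_transform_eventually)
    thus ?thesis by simp
  qed
  have mean_c: "(\<lambda>n. real n * truncated_mean (c * u n) / D n) \<longlonglongrightarrow> c powr (1 - \<alpha>)" if c: "c > 0" for c
  proof -
    have "((\<lambda>x. truncated_mean x / (x * tail x)) \<longlongrightarrow> \<alpha> / (1 - \<alpha>)) at_top"
      by (rule truncated_mean_asymp)
        (use truncated_mean_nonneg truncated_mean_le truncated_mean_increment in auto)
    from filterlim_compose[OF this cu[OF c]]
    have "(\<lambda>n. truncated_mean (c * u n) / ((c * u n) * tail (c * u n))
        * (c / (\<alpha> / (1 - \<alpha>)) * (real n * tail (c * u n) / real (b n))))
        \<longlonglongrightarrow> \<alpha> / (1 - \<alpha>) * (c / (\<alpha> / (1 - \<alpha>)) * c powr (- \<alpha>))"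
      by (intro tendsto_mult tail_c[OF c] tendsto_const)
    also have "\<alpha> / (1 - \<alpha>) * (c / (\<alpha> / (1 - \<alpha>)) * c powr (- \<alpha>)) = c powr (1 - \<alpha>)"
    proof -
      have "r * (c / r * z) = c * z" if "r > 0" for r z :: real using that by simp
      from this[OF ratio, of "c powr (- \<alpha>)"] show ?thesis
        using c by (simp add: powr_diff powr_minus divide_inverse)
    qed
    finally show ?thesis
    proof (rule Lim_transform_eventually)
      show "eventually (\<lambda>n. truncated_mean (c * u n) / ((c * u n) * tail (c * u n))
        * (c / (\<alpha> / (1 - \<alpha>)) * (real n * tail (c * u n) / real (b n)))
        = real n * truncated_mean (c * u n) / D n) sequentially"
        using u0
      proof eventually_elim
        case (elim n)
        have "tail (c * u n) > 0" using G_pos elim c by simp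
        thus ?case using elim c alpha by (simp add: D_def mult_ac)
      qed
    qed
  qed
  define A where "A c \<eta> n = {\<omega> \<in> space M. \<eta> \<le> \<bar>(\<Sum>k<n. ?e (c * u n) ((T ^^ k) \<omega>)) / real (b n) - c powr (- \<alpha>)\<bar>}" for c \<eta> n
  define B where "B c \<eta> n = {\<omega> \<in> space M. \<eta> \<le> \<bar>(\<Sum>k<n. ?t (c * u n) ((T ^^ k) \<omega>)) / D n - c powr (1 - \<alpha>)\<bar>}" for c \<eta> n
  have emeas [measurable]: "?e l \<in> borel_measurable M" for l
  proof -
    have "(\<lambda>\<omega>. if l < chi \<omega> then 1 else 0 :: real) \<in> borel_measurable M" by measurable
    thus ?thesis by (simp add: indicator_def)
  qed
  have tmeas [measurable]: "?t l \<in> borel_measurable M" for l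
  proof -
    have "(\<lambda>\<omega>. chi \<omega> * (if chi \<omega> \<le> l then 1 else 0 :: real)) \<in> borel_measurable M" by measurable
    thus ?thesis by (simp add: indicator_def)
  qed
  have sets [measurable]: "A c \<eta> n \<in> sets M" "B c \<eta> n \<in> sets M" for c \<eta> n
    unfolding A_def B_def by measurable
  have Alim: "(\<lambda>n. measure M (A c \<eta> n)) \<longlonglongrightarrow> 0" if c: "c > 0" and "\<eta> > 0" for c \<eta>
    unfolding A_def
  proof (rule weak_law_array[where K = "\<lambda>_. K"])
    show "eventually (\<lambda>n. (\<lambda>x. complex_of_real (?e (c * u n) x)) \<in> F \<and> (\<forall>x\<in>space M. 0 \<le> ?e (c * u n) x) \<and>
       nrm (\<lambda>x. complex_of_real (?e (c * u n) x)) \<le> K \<and> 0 < real (b n)) sequentially"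
      using u0 b0 by eventually_elim (use K(2) c in auto)
    show "(\<lambda>n. real n * (LINT x|M. ?e (c * u n) x) / real (b n)) \<longlonglongrightarrow> c powr (- \<alpha>)"
      using tail_c[OF c] by (simp add: tail_eq_integral)
    show "(\<lambda>n. K / real (b n)) \<longlonglongrightarrow> 0"
      using tendsto_mult_right_zero[OF inv_b, of K] by (simp add: divide_inverse)
  qed fact
  have Blim: "(\<lambda>n. measure M (B c \<eta> n)) \<longlonglongrightarrow> 0" if c: "c > 0" and "\<eta> > 0" for c \<eta>
    unfolding B_def
  proof (rule weak_law_array[where K = "\<lambda>n. K * (c * u n)"])
    show "eventually (\<lambda>n. (\<lambda>x. complex_of_real (?t (c * u n) x)) \<in> F \<and> (\<forall>x\<in>space M. 0 \<le> ?t (c * u n) x) \<and>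
       nrm (\<lambda>x. complex_of_real (?t (c * u n) x)) \<le> K * (c * u n) \<and> 0 < D n) sequentially"
      using u0 D0 by eventually_elim (use K(2) c chi_nonneg in auto)
    show "(\<lambda>n. real n * (LINT x|M. ?t (c * u n) x) / D n) \<longlonglongrightarrow> c powr (1 - \<alpha>)"
      using mean_c[OF c] by (simp add: truncated_mean_def)
    have "(\<lambda>n. K * c / (\<alpha> / (1 - \<alpha>)) * inverse (real (b n))) \<longlonglongrightarrow> 0"
      by (rule tendsto_mult_right_zero[OF inv_b])
    thus "(\<lambda>n. K * (c * u n) / D n) \<longlonglongrightarrow> 0"
      by (rule Lim_transform_eventually)
        (use u0 in eventually_elim, use alpha in \<open>simp add: D_def inverse_eq_divide mult_ac\<close>)
  qed fact
  have "((\<lambda>c. c powr (1 - \<alpha>)) \<longlongrightarrow> 1 powr (1 - \<alpha>)) (at 1)"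
    by (intro tendsto_intros) auto
  from tendstoD[OF this, of "\<epsilon> / 2"] \<open>\<epsilon> > 0\<close>
  obtain d where d: "d > 0" "\<And>c. c \<noteq> 1 \<Longrightarrow> dist c 1 < d \<Longrightarrow> dist (c powr (1 - \<alpha>)) 1 < \<epsilon> / 2"
    unfolding eventually_at by auto
  have near: "1 - \<epsilon> / 2 < c powr (1 - \<alpha>) \<and> c powr (1 - \<alpha>) < 1 + \<epsilon> / 2"
    if "c \<noteq> 1" "\<bar>c - 1\<bar> < d" for c
    using d(2)[of c] that unfolding dist_real_def abs_less_iff by linarith
  define \<delta> where "\<delta> = min d 1 / 2"
  have \<delta>: "0 < \<delta>" "\<delta> < 1" "\<delta> < d" using d by (auto simp: \<delta>_def)
  define c1 where "c1 = 1 + \<delta>"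
  define c2 where "c2 = 1 - \<delta>"
  have c1: "c1 > 1" "c1 powr (1 - \<alpha>) < 1 + \<epsilon> / 2"
    using \<delta> near[of c1] by (auto simp: c1_def)
  have c2: "0 < c2" "c2 < 1" "c2 powr (1 - \<alpha>) > 1 - \<epsilon> / 2"
    using \<delta> near[of c2] by (auto simp: c2_def)
  \<comment> \<open>The margins by which the expected counts, in units of \<open>b n\<close>, miss \<open>1\<close>.\<close>
  define \<eta>1 where "\<eta>1 = 1 - c1 powr (- \<alpha>)"
  define \<eta>2 where "\<eta>2 = c2 powr (- \<alpha>) - 1"
  have \<eta>1: "\<eta>1 > 0" unfolding \<eta>1_def using c1 alpha by (simp add: powr_less_one)
  have "c2 powr \<alpha> < 1" using powr_less_mono2[of \<alpha> c2 1] c2 alpha by simp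
  hence \<eta>2: "\<eta>2 > 0" unfolding \<eta>2_def using c2 by (simp add: powr_minus one_less_inverse)
  let ?E = "\<lambda>n. {\<omega> \<in> space M. \<bar>trimmed_sum T chi n (b n) \<omega> / D n - 1\<bar> > \<epsilon>}"
  let ?S = "\<lambda>n. measure M (A c1 \<eta>1 n) + measure M (B c1 (\<epsilon> / 2) n) + (measure M (A c2 \<eta>2 n) + measure M (B c2 (\<epsilon> / 2) n))"
  have "eventually (\<lambda>n. measure M (?E n) \<le> ?S n) sequentially"
    using u0 b0 D0
  proof eventually_elim
    case (elim n)
    have "?E n \<subseteq> (A c1 \<eta>1 n \<union> B c1 (\<epsilon> / 2) n) \<union> (A c2 \<eta>2 n \<union> B c2 (\<epsilon> / 2) n)"
    proof (rule subsetI, rule ccontr)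
      fix \<omega> assume \<omega>: "\<omega> \<in> ?E n" and "\<omega> \<notin> (A c1 \<eta>1 n \<union> B c1 (\<epsilon> / 2) n) \<union> (A c2 \<eta>2 n \<union> B c2 (\<epsilon> / 2) n)"
      hence out: "\<omega> \<notin> A c1 \<eta>1 n" "\<omega> \<notin> B c1 (\<epsilon> / 2) n" "\<omega> \<notin> A c2 \<eta>2 n" "\<omega> \<notin> B c2 (\<epsilon> / 2) n"
        and sp: "\<omega> \<in> space M" by auto
      let ?xs = "map (\<lambda>k. chi ((T ^^ k) \<omega>)) [0..<n]"
      let ?N = "\<lambda>c. length (filter (\<lambda>x. x > c * u n) ?xs)"
      let ?T = "\<lambda>c. sum_list (filter (\<lambda>x. x \<le> c * u n) ?xs)"
      have nonneg: "0 \<le> x" if "x \<in> set ?xs" for x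
        using that sp measurable_space[OF funpow_T_measurable] by (auto intro: chi_nonneg)
      have N: "\<bar>real (?N c) / real (b n) - c powr (- \<alpha>)\<bar> < \<eta>" if "\<omega> \<notin> A c \<eta> n" for c \<eta>
        unfolding exceedances_eq using that sp by (simp add: A_def)
      have Tn: "\<bar>?T c / D n - c powr (1 - \<alpha>)\<bar> < \<eta>" if "\<omega> \<notin> B c \<eta> n" for c \<eta>
        unfolding truncated_sum_eq using that sp by (simp add: B_def)
      have "real (?N c1) / real (b n) < 1" using N[OF out(1)] unfolding \<eta>1_def by linarith
      hence "?N c1 \<le> b n" using elim by simp
      hence "trimmed_sum T chi n (b n) \<omega> \<le> ?T c1"
        unfolding trimmed_sum_def by (rule trimmed_le_truncated[rotated]) (rule nonneg)
      hence "trimmed_sum T chi n (b n) \<omega> / D n \<le> ?T c1 / D n" using elim by (simp add: divide_right_mono)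
      hence hi: "trimmed_sum T chi n (b n) \<omega> / D n < 1 + \<epsilon>" using Tn[OF out(2)] c1 by linarith
      have "real (?N c2) / real (b n) > 1" using N[OF out(3)] unfolding \<eta>2_def by linarith
      hence "b n \<le> ?N c2" using elim by simp
      hence "?T c2 \<le> trimmed_sum T chi n (b n) \<omega>"
        unfolding trimmed_sum_def by (rule truncated_le_trimmed[rotated]) (use elim c2 in simp)
      hence "?T c2 / D n \<le> trimmed_sum T chi n (b n) \<omega> / D n" using elim by (simp add: divide_right_mono)
      hence lo: "trimmed_sum T chi n (b n) \<omega> / D n > 1 - \<epsilon>" using Tn[OF out(4)] c2 by linarith
      from \<omega> hi lo show False by auto
    qed
    hence "measure M (?E n) \<le> measure M ((A c1 \<eta>1 n \<union> B c1 (\<epsilon> / 2) n) \<union> (A c2 \<eta>2 n \<union> B c2 (\<epsilon> / 2) n))"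
      by (rule finite_measure_mono) measurable
    also have "\<dots> \<le> ?S n"
      by (intro order_trans[OF measure_Un_le] add_mono measure_Un_le) measurable
    finally show ?case .
  qed
  moreover have "?S \<longlonglongrightarrow> 0"
    using c1 c2 \<eta>1 \<eta>2 \<open>\<epsilon> > 0\<close> by (intro tendsto_add_zero Alim Blim) auto
  ultimately have "(\<lambda>n. measure M (?E n)) \<longlonglongrightarrow> 0"
    by (rule tendsto_sandwich[OF always_eventually[OF allI[OF measure_nonneg]] _ tendsto_const])
  thus ?thesis unfolding D_def .
qed

end

theorem lemma2p2:
  fixes M :: "'a measure" and T :: "'a \<Rightarrow> 'a"
    and F :: "('a \<Rightarrow> complex) set" and nrm :: "('a \<Rightarrow> complex) \<Rightarrow> real"
    and That :: "('a \<Rightarrow> complex) \<Rightarrow> ('a \<Rightarrow> complex)"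
    and chi :: "'a \<Rightarrow> real" and \<alpha> :: real and L Ls :: "real \<Rightarrow> real"
    and b :: "nat \<Rightarrow> nat"
  assumes "property_D M T F nrm That chi"
    and "0 < \<alpha>" and "\<alpha> < 1"
    and "slowly_varying L"
    and "\<And>x. x > 0 \<Longrightarrow> measure M {\<omega> \<in> space M. chi \<omega> > x} = L x / x powr \<alpha>"
    and "de_bruijn_conjugate (\<lambda>x. L x powr (- 1 / \<alpha>)) Ls"
    and "\<And>n. n \<ge> 1 \<Longrightarrow> b n \<ge> 1"
    and "filterlim b at_top sequentially"
    and "(\<lambda>n. real (b n)) \<in> o(\<lambda>n. real n)"
  shows "\<forall>\<epsilon>>0. (\<lambda>n. measure M {\<omega> \<in> space M.
           \<bar>trimmed_sum T chi n (b n) \<omega> / norming \<alpha> Ls b n - 1\<bar> > \<epsilon>}) \<longlonglongrightarrow> 0"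
proof (intro allI impI)
  fix \<epsilon> :: real assume "\<epsilon> > 0"
  interpret property_D M T F nrm That chi by fact
  note [measurable] = chi_measurable
  have tail: "tail x = L x / x powr \<alpha>" if "x > 0" for x
    using assms(5)[OF that] by (simp add: tail_def)
  have tail_antimono: "tail y \<le> tail x" if "x \<le> y" for x y
    unfolding tail_def by (rule finite_measure_mono) (use that in auto)
  have tail_nonneg: "tail x \<ge> 0" for x unfolding tail_def by simp
  have tail_pos: "tail x > 0" for x
  proof -
    have "((\<lambda>x. L (1 * x) / L x) \<longlongrightarrow> 1) at_top"
      using assms(4) unfolding slowly_varying_def by (metis zero_less_one)
    hence "eventually (\<lambda>x. 0 < L (1 * x) / L x) at_top" by (rule order_tendstoD) simp
    hence "eventually (\<lambda>y. L y \<noteq> 0 \<and> y \<ge> max x 1) at_top"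
      using eventually_ge_at_top[of "max x 1"] by eventually_elim auto
    then obtain y where "L y \<noteq> 0" "y \<ge> max x 1"
      by (metis (mono_tags, lifting) eventually_at_top_linorder order_refl)
    hence "tail y \<noteq> 0" "x \<le> y" by (simp_all add: tail)
    with tail_nonneg[of y] tail_antimono[of x y] show ?thesis by linarith
  qed
  have rv: "regularly_varying_tail tail \<alpha>"
  proof
    fix c :: real assume c: "c > 0"
    have "((\<lambda>x. L (c * x) / L x * c powr (- \<alpha>)) \<longlongrightarrow> 1 * c powr (- \<alpha>)) at_top"
      using assms(4) c unfolding slowly_varying_def by (intro tendsto_mult tendsto_const) auto
    moreover have "eventually (\<lambda>x. L (c * x) / L x * c powr (- \<alpha>) = tail (c * x) / tail x) at_top"
      using eventually_gt_at_top[of 0]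
      by eventually_elim (use c in \<open>simp add: tail powr_mult powr_minus field_simps\<close>)
    ultimately show "((\<lambda>x. tail (c * x) / tail x) \<longlongrightarrow> c powr (- \<alpha>)) at_top"
      by (simp add: tendsto_cong)
  qed (use assms tail_pos tail_antimono in auto)
  define y where "y n = (real n / real (b n)) powr (1 / \<alpha>)" for n
  define u where "u n = y n * Ls (y n)" for n
  note thr = calibrated_threshold[OF \<open>0 < \<alpha>\<close> tail_nonneg tail assms(6)]
  have b0: "eventually (\<lambda>n. n \<ge> 1 \<and> b n \<ge> 1) sequentially"
    using eventually_ge_at_top[of 1] by eventually_elim (use assms(7) in auto)
  have nb: "filterlim (\<lambda>n. real n / real (b n)) at_top sequentially"
  proof -
    have "(\<lambda>n. real (b n) / real n) \<longlonglongrightarrow> 0" using assms(9) by (rule smalloD_tendsto)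
    moreover have "eventually (\<lambda>n. real (b n) / real n > 0) sequentially"
      using b0 by eventually_elim auto
    ultimately have "filterlim (\<lambda>n. inverse (real (b n) / real n)) at_top sequentially"
      by (rule filterlim_inverse_at_top)
    thus ?thesis by simp
  qed
  have y: "filterlim y at_top sequentially"
    unfolding filterlim_at_top_gt[where c = 0]
  proof (intro allI impI)
    fix Z :: real assume Z: "Z > 0"
    have "eventually (\<lambda>n. Z powr \<alpha> \<le> real n / real (b n)) sequentially"
      using nb unfolding filterlim_at_top by blast
    thus "eventually (\<lambda>n. Z \<le> y n) sequentially"
    proof eventually_elim
      case (elim n)
      have "(Z powr \<alpha>) powr (1 / \<alpha>) \<le> y n"
        unfolding y_def by (rule powr_mono2) (use elim assms in auto)
      thus ?case using Z assms by (simp add: powr_powr)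
    qed
  qed
  have y_alpha: "y n powr \<alpha> = real n / real (b n)" for n
    unfolding y_def using assms by (simp add: powr_powr)
  have calib: "(\<lambda>n. real n * tail (u n) / real (b n)) \<longlonglongrightarrow> 1"
    using filterlim_compose[OF thr(1) y] by (simp add: u_def y_alpha)
  have "(\<lambda>n. inverse (real n / real (b n))) \<longlonglongrightarrow> 0"
    by (rule tendsto_inverse_0_at_top[OF nb])
  from tendsto_mult[OF calib this]
  have "(\<lambda>n. (real n * tail (u n) / real (b n)) * inverse (real n / real (b n))) \<longlonglongrightarrow> 0" by simp
  hence tail_u: "(\<lambda>n. tail (u n)) \<longlonglongrightarrow> 0"
    by (rule Lim_transform_eventually) (use b0 in eventually_elim, auto)
  \<comment> \<open>Levels with vanishing tail are unbounded, as the monotone tail is positive everywhere.\<close>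
  have u: "filterlim u at_top sequentially"
    unfolding filterlim_at_top
  proof
    fix Z :: real
    from order_tendstoD(2)[OF tail_u tail_pos[of Z]]
    show "eventually (\<lambda>n. Z \<le> u n) sequentially"
    proof eventually_elim
      case (elim n)
      show ?case using tail_antimono[of "u n" Z] elim by linarith
    qed
  qed
  have norming: "norming \<alpha> Ls b n = \<alpha> / (1 - \<alpha>) * real (b n) * u n" for n
  proof (cases "n = 0")
    case False
    hence "b n > 0" using assms(7)[of n] by simp
    thus ?thesis unfolding norming_def u_def y_def using False
      by (simp add: powr_divide powr_diff)
  qed (simp add: norming_def u_def y_def)
  from trimmed_sum_weak_law[OF rv u assms(8) calib \<open>\<epsilon> > 0\<close>]
  show "(\<lambda>n. measure M {\<omega> \<in> space M.
           \<bar>trimmed_sum T chi n (b n) \<omega> / norming \<alpha> Ls b n - 1\<bar> > \<epsilon>}) \<longlonglongrightarrow> 0"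
    by (simp only: norming)
qed

end
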